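(* Let $G$ be a finite group and let $C_1, \dots, C_n$ be cyclic subgroups of $G$. Let $V$ be the subspace of the complex vector space of complex valued class functions of $G$ spanned (over $\mathbb{C}$) by the rational valued characters of $G$. Then the following are true: \begin{enumerate} \item $(1_{C_1})^G, \dots, (1_{C_n})^G$ spans $V$ if and only if every conjugacy class of cyclic subgroups of $G$ is represented among the $C_i$'s. \item $(1_{C_1})^G, \dots, (1_{C_n})^G$ is a basis for $V$ if and only if $C_1, \dots, C_n$ is a set of representatives for all the conjugacy classes of cyclic subgroups of $G$ (each conjugacy class being represented exactly once). \end{enumerate}
   Context: A class function on $G$ is a function $G \to \mathbb{C}$ that is constant on the conjugacy classes of $G$; the class functions form a complex vector space under pointwise addition and scalar multiplication, with the set $\mathrm{Irr}(G)$ of irreducible complex characters as a basis. A character of $G$ is a linear combination of elements of $\mathrm{Irr}(G)$ with nonnegative integer coefficients that are not all $0$. A character (or class function) is rational valued if all of its values lie in $\mathbb{Q}$. For a subgroup $H$ of $G$, $1_H$ denotes the principal (trivial) character of $H$ and $(1_H)^G$ denotes the character of $G$ induced from $1_H$. Conjugacy classes of cyclic subgroups are the orbits of $G$ acting by conjugation on the set of its cyclic subgroups (including the trivial subgroup). *)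

theory Defs
  imports
    "HOL-Algebra.Group_Action"
    "HOL-Algebra.Elementary_Groups"
    "HOL-Library.Function_Algebras"
    "HOL-Library.Indicator_Function"
    "Jordan_Normal_Form.VS_Connect"
begin

text \<open>
  Functions on a group are total functions on the underlying type that vanish outside the carrier.
  With this convention the pointwise operations and \<open>0\<close> on the function type agree with
  those on complex-valued functions on the carrier.
\<close>

global_interpretation cfun: vector_space "\<lambda>(c::complex) (f::'a \<Rightarrow> complex) x. c * f x"
  by unfold_locales (auto simp: fun_eq_iff algebra_simps)

definition class_functions :: "('a, 'b) monoid_scheme \<Rightarrow> ('a \<Rightarrow> complex) set" where
  "class_functions G =
    {f. (\<forall>x. x \<notin> carrier G \<longrightarrow> f x = 0) \<and>
        (\<forall>x\<in>carrier G. \<forall>g\<in>carrier G. f (g \<otimes>\<^bsub>G\<^esub> x \<otimes>\<^bsub>G\<^esub> inv\<^bsub>G\<^esub> g) = f x)}"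

text \<open>A basis as an indexed family: repeated members make the family linearly dependent.\<close>

definition basis_family :: "'i set \<Rightarrow> ('i \<Rightarrow> 'a \<Rightarrow> complex) \<Rightarrow> ('a \<Rightarrow> complex) set \<Rightarrow> bool" where
  "basis_family I f V \<longleftrightarrow>
     inj_on f I \<and> cfun.independent (f ` I) \<and> cfun.span (f ` I) = V"

definition GL :: "nat \<Rightarrow> complex mat monoid" where
  "GL n = units_of (ring_mat TYPE(complex) n ())"

definition mat_trace :: "complex mat \<Rightarrow> complex" where
  "mat_trace A = (\<Sum>i<dim_row A. A $$ (i, i))"

definition irreducible_rep ::
    "('a, 'b) monoid_scheme \<Rightarrow> nat \<Rightarrow> ('a \<Rightarrow> complex mat) \<Rightarrow> bool" where
  "irreducible_rep G n \<rho> \<longleftrightarrow>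
     \<rho> \<in> hom G (GL n) \<and> n > 0 \<and>
     (\<forall>W. VectorSpace.subspace class_ring W (module_vec TYPE(complex) n) \<and>
          (\<forall>g\<in>carrier G. \<forall>w\<in>W. \<rho> g *\<^sub>v w \<in> W) \<longrightarrow>
          W = {0\<^sub>v n} \<or> W = carrier_vec n)"

definition Irr :: "('a, 'b) monoid_scheme \<Rightarrow> ('a \<Rightarrow> complex) set" where
  "Irr G = {\<chi>. \<exists>n \<rho>. irreducible_rep G n \<rho> \<and>
                   \<chi> = (\<lambda>g. if g \<in> carrier G then mat_trace (\<rho> g) else 0)}"

text \<open>
  The finite set \<open>S\<close> keeps the definition independent of the finiteness of \<^term>\<open>Irr G\<close>.
\<close>

definition is_character :: "('a, 'b) monoid_scheme \<Rightarrow> ('a \<Rightarrow> complex) \<Rightarrow> bool" where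
  "is_character G \<chi> \<longleftrightarrow>
     (\<exists>S m. finite S \<and> S \<subseteq> Irr G \<and> (\<exists>\<psi>\<in>S. m \<psi> \<noteq> (0::nat)) \<and>
            \<chi> = (\<lambda>g. \<Sum>\<psi>\<in>S. of_nat (m \<psi>) * \<psi> g))"

definition rational_valued :: "('a, 'b) monoid_scheme \<Rightarrow> ('a \<Rightarrow> complex) \<Rightarrow> bool" where
  "rational_valued G f \<longleftrightarrow> (\<forall>g\<in>carrier G. f g \<in> \<rat>)"

definition rational_character_span :: "('a, 'b) monoid_scheme \<Rightarrow> ('a \<Rightarrow> complex) set" where
  "rational_character_span G = cfun.span {\<chi>. is_character G \<chi> \<and> rational_valued G \<chi>}"

definition principal_character :: "'a set \<Rightarrow> 'a \<Rightarrow> complex" where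
  "principal_character H = indicator H"

text \<open>Frobenius' formula, with the class function \<open>\<phi>\<close> of \<open>H\<close> extended by zero to \<open>G\<close>.\<close>

definition induced :: "('a, 'b) monoid_scheme \<Rightarrow> 'a set \<Rightarrow> ('a \<Rightarrow> complex) \<Rightarrow> 'a \<Rightarrow> complex" where
  "induced G H \<phi> g =
     (if g \<in> carrier G
      then (\<Sum>x\<in>carrier G.
              let y = x \<otimes>\<^bsub>G\<^esub> g \<otimes>\<^bsub>G\<^esub> inv\<^bsub>G\<^esub> x in if y \<in> H then \<phi> y else 0)
           / of_nat (card H)
      else 0)"

definition cyclic_subgroups :: "('a, 'b) monoid_scheme \<Rightarrow> 'a set set" where
  "cyclic_subgroups G = {H. subgroup H G \<and> cyclic_group (G\<lparr>carrier := H\<rparr>)}"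

definition cyclic_subgroup_classes :: "('a, 'b) monoid_scheme \<Rightarrow> 'a set set set" where
  "cyclic_subgroup_classes G =
     orbits G (cyclic_subgroups G)
       (\<lambda>g. \<lambda>H\<in>cyclic_subgroups G. g <#\<^bsub>G\<^esub> H #>\<^bsub>G\<^esub> (inv\<^bsub>G\<^esub> g))"


subsection \<open>The functions above are class functions\<close>

lemma mat_trace_mult_comm:
  assumes "A \<in> carrier_mat n n" "B \<in> carrier_mat n n"
  shows "mat_trace (A * B) = mat_trace (B * A)"
proof -
  have "mat_trace (A * B) = (\<Sum>i<n. \<Sum>j<n. A $$ (i, j) * B $$ (j, i))"
    using assms by (auto simp: mat_trace_def scalar_prod_def lessThan_atLeast0 intro!: sum.cong)
  also have "\<dots> = (\<Sum>j<n. \<Sum>i<n. B $$ (j, i) * A $$ (i, j))"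
    by (subst sum.swap) (simp add: mult.commute)
  also have "\<dots> = mat_trace (B * A)"
    using assms by (auto simp: mat_trace_def scalar_prod_def lessThan_atLeast0 intro!: sum.cong)
  finally show ?thesis .
qed

lemma group_GL: "group (GL n)"
proof -
  interpret ring "ring_mat TYPE(complex) n ()" by (rule ring_mat)
  show ?thesis unfolding GL_def by (rule units_group)
qed

lemma GL_simps:
  "x \<in> carrier (GL n) \<Longrightarrow> x \<in> carrier_mat n n"
  "x \<otimes>\<^bsub>GL n\<^esub> y = x * y" "\<one>\<^bsub>GL n\<^esub> = 1\<^sub>m n"
  by (auto simp: GL_def units_of_def Units_def ring_mat_simps)

lemma (in group) Irr_class_function:
  assumes "\<chi> \<in> Irr G"
  shows "\<chi> \<in> class_functions G"
proof -
  obtain n \<rho> where \<rho>: "\<rho> \<in> hom G (GL n)"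
    and \<chi>: "\<chi> = (\<lambda>g. if g \<in> carrier G then mat_trace (\<rho> g) else 0)"
    using assms unfolding Irr_def irreducible_rep_def by blast
  have cancel: "inv g \<otimes> (g \<otimes> x) = x" if "g \<in> carrier G" "x \<in> carrier G" for g x
    using that by (simp flip: m_assoc)
  interpret group_hom G "GL n" \<rho>
    using \<rho> group_GL by (simp add: group_hom_def group_hom_axioms_def)
  have car: "\<rho> g \<in> carrier_mat n n" if "g \<in> carrier G" for g
    using hom_closed[OF that] GL_simps(1) by blast
  have "mat_trace (\<rho> (g \<otimes> x \<otimes> inv g)) = mat_trace (\<rho> x)"
    if g: "g \<in> carrier G" and x: "x \<in> carrier G" for g x
  proof -
    have "mat_trace (\<rho> (g \<otimes> x \<otimes> inv g)) = mat_trace (\<rho> (g \<otimes> x) * \<rho> (inv g))"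
      using g x hom_mult[of "g \<otimes> x" "inv g"] by (simp add: GL_simps)
    also have "\<dots> = mat_trace (\<rho> (inv g) * \<rho> (g \<otimes> x))"
      using g x by (intro mat_trace_mult_comm[where n = n] car) auto
    also have "\<dots> = mat_trace (\<rho> (inv g \<otimes> (g \<otimes> x)))"
      using g x hom_mult[of "inv g" "g \<otimes> x"] by (simp add: GL_simps)
    also have "inv g \<otimes> (g \<otimes> x) = x"
      using g x by (rule cancel)
    finally show ?thesis .
  qed
  then show ?thesis
    unfolding class_functions_def \<chi> by auto
qed

lemma subspace_class_functions: "cfun.subspace (class_functions G)"
  by (auto simp: cfun.subspace_def class_functions_def)

lemma (in group) rational_character_span_class_functions:
  "rational_character_span G \<subseteq> class_functions G"
  unfolding rational_character_span_def
proof (rule cfun.span_minimal[OF _ subspace_class_functions], safe)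
  fix \<chi> assume "is_character G \<chi>"
  then obtain S m where S: "S \<subseteq> Irr G"
    and \<chi>: "\<chi> = (\<lambda>g. \<Sum>\<psi>\<in>S. of_nat (m \<psi>) * \<psi> g)"
    unfolding is_character_def by blast
  have "\<psi> \<in> class_functions G" if "\<psi> \<in> S" for \<psi>
    using S that Irr_class_function by blast
  then show "\<chi> \<in> class_functions G"
    unfolding \<chi> class_functions_def by (auto intro!: sum.neutral sum.cong)
qed

lemma (in group) induced_class_function: "induced G H \<phi> \<in> class_functions G"
proof -
  let ?f = "\<lambda>y. if y \<in> H then \<phi> y else 0"
  have "(\<Sum>x\<in>carrier G. ?f (x \<otimes> (g \<otimes> a \<otimes> inv g) \<otimes> inv x)) =
        (\<Sum>x\<in>carrier G. ?f (x \<otimes> a \<otimes> inv x))"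
    if a: "a \<in> carrier G" and g: "g \<in> carrier G" for a g
  proof (rule sum.reindex_bij_witness[of _ "\<lambda>x. x \<otimes> inv g" "\<lambda>x. x \<otimes> g"])
    fix x assume x: "x \<in> carrier G"
    have "x \<otimes> g \<otimes> a \<otimes> inv (x \<otimes> g) = x \<otimes> (g \<otimes> a \<otimes> inv g) \<otimes> inv x"
      using a g x by (simp add: inv_mult_group m_assoc)
    then show "?f (x \<otimes> g \<otimes> a \<otimes> inv (x \<otimes> g)) = ?f (x \<otimes> (g \<otimes> a \<otimes> inv g) \<otimes> inv x)"
      by simp
  qed (use g in \<open>auto simp: m_assoc\<close>)
  then show ?thesis
    by (auto simp: class_functions_def induced_def Let_def)
qed

end

theory Submission
  imports Defs "HOL-Algebra.Multiplicative_Group" "Jordan_Normal_Form.Schur_Decomposition"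
    "HOL-Number_Theory.Cong"
begin

text \<open>
  Write \<open>1\<^sub>C\<^sup>G\<close> for the character of \<open>G\<close> induced from the principal character of \<open>C\<close>, and let
  \<open>W\<close> be the space of class functions that take equal values on any two generators of the same
  cyclic subgroup (\<open>rational_class_functions\<close>).  The idea is that the span \<open>V\<close> of the rational
  valued characters is \<open>W\<close>, whose dimension is visibly the number \<open>N\<close> of conjugacy classes of
  cyclic subgroups, and that the \<open>1\<^sub>C\<^sup>G\<close> with \<open>C\<close> cyclic already span it.  Three inclusions form a
  circle.

  First, \<open>V \<subseteq> W\<close> (\<open>rational_character_span_subset\<close>).  If \<open>x\<close> has order \<open>m\<close>, a character satisfies
  \<open>\<chi> (x\<^sup>j) = P(\<zeta>\<^sup>j)\<close> for one integer polynomial \<open>P\<close> and one \<open>m\<close>-th root of unity \<open>\<zeta>\<close>, because the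
  eigenvalues of a matrix of finite order are roots of unity.  If all these values are rational,
  they are ordinary integers, and \<open>P(\<zeta>\<^sup>p) \<equiv> P(\<zeta>)\<^sup>p \<equiv> P(\<zeta>)\<close> modulo a prime \<open>p\<close>.  For \<open>p\<close> larger than
  twice the absolute value of each of them, this congruence is an equality.  Any exponent prime to
  \<open>m\<close> is congruent modulo \<open>m\<close> to a product of such large primes, by the Chinese remainder theorem,
  so \<open>\<chi>\<close> agrees at all generators of the subgroup generated by \<open>x\<close>
  (\<open>rational_values_coprime_power\<close>).

  Second, \<open>W\<close> is spanned by the \<open>1\<^sub>C\<^sup>G\<close> with \<open>C\<close> cyclic
  (\<open>in_span_if_vanishing_above_order\<close>), by downward elimination: among elements of order
  \<open>k\<close>, the function \<open>1\<^sub>C\<^sup>G\<close> with \<open>C\<close> of order \<open>k\<close> only sees the generators of conjugates of \<open>C\<close>,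
  and it vanishes at all elements of larger order.

  Third, each \<open>1\<^sub>C\<^sup>G\<close> is a rational valued character: its value at \<open>g\<close> is the number of cosets of
  \<open>C\<close> fixed by \<open>g\<close>, the trace of a permutation matrix.  The trace of any matrix representation is a
  character (\<open>is_character_trace_function\<close>), since a proper invariant subspace makes the
  representation block triangular and the trace is the sum of the traces of the diagonal blocks.

  The theorem is then a dimension count.  The indicator functions of the \<open>N\<close> classes are linearly
  independent elements of \<open>W = V\<close>, so a spanning set of \<open>V\<close> has at least \<open>N\<close> elements
  (\<open>card_spanning_ge_card_classes\<close>).  As \<open>1\<^sub>C\<^sup>G\<close> depends only on the class of \<open>C\<close>, a family of such
  functions spans \<open>V\<close> exactly when it meets all \<open>N\<close> classes, and a spanning family is a basis
  exactly when it meets each class once.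
\<close>


section \<open>Rational values of integer polynomials at roots of unity\<close>

lemma algebraic_int_if_int_eigenvector:
  fixes M :: "int mat" and z :: complex
  assumes M: "M \<in> carrier_mat n n" and v: "v \<in> carrier_vec n" "v \<noteq> 0\<^sub>v n"
    and eq: "map_mat of_int M *\<^sub>v v = z \<cdot>\<^sub>v v"
  shows "algebraic_int z"
proof -
  have M': "map_mat of_int M \<in> carrier_mat n n" using M by simp
  have "eigenvalue (map_mat complex_of_int M) z"
    using M M' v eq by (auto simp: eigenvalue_def eigenvector_def)
  hence "poly (char_poly (map_mat complex_of_int M)) z = 0"
    using eigenvalue_root_char_poly[OF M', of z] by blast
  also have "char_poly (map_mat complex_of_int M) = map_poly of_int (char_poly M)"
    by (rule of_int_hom.char_poly_hom[OF M])
  finally show ?thesis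
    unfolding algebraic_int_altdef_ipoly using degree_monic_char_poly[OF M] by blast
qed

lemma power_mod_root_of_unity:
  fixes z :: "'a::monoid_mult"
  assumes "z ^ m = 1"
  shows "z ^ (i mod m) = z ^ i"
proof -
  have "z ^ i = z ^ (m * (i div m) + i mod m)" by simp
  also have "\<dots> = z ^ (i mod m)" by (simp only: power_add power_mult assms power_one mult_1)
  finally show ?thesis by simp
qed

text \<open>
  Multiplication by \<open>P(z)\<close> on the span of \<open>1, z, \<dots>, z\<^sup>m\<^sup>-\<^sup>1\<close> is given by a circulant integer
  matrix, which has the vector of these powers as an eigenvector.
\<close>

lemma algebraic_int_poly_root_of_unity:
  fixes P :: "int poly" and z :: complex
  assumes m: "m > 0" and z: "z ^ m = 1"
  shows "algebraic_int (poly (map_poly of_int P) z)"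
proof -
  define M where "M = mat m m (\<lambda>(j,l). \<Sum>i\<in>{i. i \<le> degree P \<and> (i + j) mod m = l}. Polynomial.coeff P i)"
  define v where "v = vec m (\<lambda>l. z ^ l)"
  have pw: "z ^ (i mod m) = z ^ i" for i
    by (rule power_mod_root_of_unity[OF z])
  show ?thesis
  proof (rule algebraic_int_if_int_eigenvector)
    show "M \<in> carrier_mat m m" by (simp add: M_def)
    show "v \<in> carrier_vec m" by (simp add: v_def)
    show "v \<noteq> 0\<^sub>v m"
    proof
      assume "v = 0\<^sub>v m"
      hence "v $ 0 = 0" using m by simp
      thus False using m by (simp add: v_def)
    qed
    show "map_mat complex_of_int M *\<^sub>v v = poly (map_poly of_int P) z \<cdot>\<^sub>v v"
    proof (rule eq_vecI)
      fix j assume "j < dim_vec (poly (map_poly complex_of_int P) z \<cdot>\<^sub>v v)"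
      hence j: "j < m" by (simp add: v_def)
      have "(map_mat complex_of_int M *\<^sub>v v) $ j = 
        (\<Sum>l<m. (\<Sum>i\<in>{i. i \<le> degree P \<and> (i + j) mod m = l}. of_int (Polynomial.coeff P i)) * z ^ l)"
        using j by (simp add: M_def v_def scalar_prod_def lessThan_atLeast0)
      also have "\<dots> = (\<Sum>l<m. (\<Sum>i\<in>{i\<in>{..degree P}. (i + j) mod m = l}. of_int (Polynomial.coeff P i) * z ^ ((i + j) mod m)))"
        by (auto simp: sum_distrib_right intro!: sum.cong)
      also have "\<dots> = (\<Sum>i\<le>degree P. of_int (Polynomial.coeff P i) * z ^ ((i + j) mod m))"
        by (rule sum.group) (use m in auto)
      also have "\<dots> = (\<Sum>i\<le>degree P. of_int (Polynomial.coeff P i) * z ^ i) * z ^ j"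
        by (simp add: pw power_add sum_distrib_right mult.assoc)
      also have "(\<Sum>i\<le>degree P. of_int (Polynomial.coeff P i) * z ^ i) = poly (map_poly of_int P) z"
        by (simp add: poly_altdef)
      finally show "(map_mat complex_of_int M *\<^sub>v v) $ j = (poly (map_poly of_int P) z \<cdot>\<^sub>v v) $ j"
        using j by (simp add: v_def)
    qed (simp add: M_def v_def)
  qed
qed

lemma prime_dvd_power_add_diff:
  fixes x y :: "'a::comm_ring_1"
  assumes p: "prime p"
  shows "of_nat p dvd (x + y) ^ p - (x ^ p + y ^ p)"
proof -
  have p0: "p > 0" using p prime_gt_0_nat by blast
  have "(x + y) ^ p = (\<Sum>k\<le>p. of_nat (p choose k) * x ^ k * y ^ (p - k))"
    by (rule binomial_ring)
  also have "{..p} = {0,p} \<union> {0<..<p}" using p0 by auto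
  also have "(\<Sum>k\<in>\<dots>. of_nat (p choose k) * x ^ k * y ^ (p - k)) = 
     (x ^ p + y ^ p) + (\<Sum>k\<in>{0<..<p}. of_nat (p choose k) * x ^ k * y ^ (p - k))"
    using p0 by (subst sum.union_disjoint) auto
  finally have "(x + y) ^ p - (x ^ p + y ^ p) = (\<Sum>k\<in>{0<..<p}. of_nat (p choose k) * x ^ k * y ^ (p - k))"
    by simp
  also have "of_nat p dvd \<dots>"
  proof (rule dvd_sum)
    fix k assume "k \<in> {0<..<p}"
    hence "p dvd (p choose k)" using p by (intro dvd_choose_prime) auto
    hence "(of_nat p :: 'a) dvd of_nat (p choose k)" by (auto elim!: dvdE)
    thus "(of_nat p :: 'a) dvd of_nat (p choose k) * x ^ k * y ^ (p - k)" by simp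
  qed
  finally show ?thesis .
qed

lemma prime_dvd_int_power_diff:
  fixes a :: int
  assumes p: "prime p"
  shows "int p dvd a ^ p - a"
proof (induction a rule: int_induct[where k = 0])
  case base
  show ?case using prime_gt_0_nat[OF p] by (simp add: power_0_left)
next
  case (step1 i)
  have "int p dvd ((i + 1) ^ p - (i ^ p + 1 ^ p)) + (i ^ p - i)"
    using prime_dvd_power_add_diff[OF p, of i 1] step1 by (intro dvd_add) auto
  thus ?case by (simp add: algebra_simps)
next
  case (step2 i)
  have "int p dvd (i ^ p - i) - ((i - 1 + 1) ^ p - ((i - 1) ^ p + 1 ^ p))"
    using prime_dvd_power_add_diff[OF p, of "i - 1" 1] step2(2) by (rule dvd_diff[rotated]) 
  thus ?case by (simp add: algebra_simps)
qed

text \<open>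
  The Frobenius congruence \<open>P(X)\<^sup>p \<equiv> P(X\<^sup>p)\<close> modulo \<open>p\<close>.
\<close>

lemma prime_dvd_poly_power_diff:
  fixes P :: "int poly"
  assumes p: "prime p"
  shows "of_nat p dvd P ^ p - pcompose P (Polynomial.monom 1 p)"
proof (induction P)
  case 0
  show ?case using prime_gt_0_nat[OF p] by (simp add: power_0_left)
next
  case (pCons a P)
  have e: "pCons a P = [:a:] + Polynomial.monom 1 1 * P" by (simp add: monom_altdef)
  have "of_nat p dvd [:a ^ p - a:]"
    using prime_dvd_int_power_diff[OF p, of a] by (auto simp: of_nat_poly const_poly_dvd)
  moreover have "of_nat p dvd Polynomial.monom 1 p * (P ^ p - pcompose P (Polynomial.monom 1 p))"
    using pCons by (intro dvd_mult)
  ultimately have "of_nat p dvd ((pCons a P) ^ p - ([:a:] ^ p + (Polynomial.monom 1 1 * P) ^ p)) +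
      [:a ^ p - a:] + Polynomial.monom 1 p * (P ^ p - pcompose P (Polynomial.monom 1 p))"
    using prime_dvd_power_add_diff[OF p, of "[:a:]" "Polynomial.monom 1 1 * P"]
    unfolding e by (intro dvd_add) auto
  also have "\<dots> = (pCons a P) ^ p - pcompose (pCons a P) (Polynomial.monom 1 p)"
    by (simp add: pcompose_pCons power_mult_distrib monom_power poly_const_pow algebra_simps)
  finally show ?case .
qed

text \<open>
  All values \<open>P(z\<^sup>j)\<close> are rational algebraic integers, hence integers.  Evaluating the Frobenius
  congruence at \<open>z\<^sup>j\<close> and using Fermat's little theorem, the integers \<open>P(z\<^sup>j\<^sup>p)\<close> and \<open>P(z\<^sup>j)\<close> differ by
  a multiple of \<open>p\<close>, and they are too close to differ by a nonzero one.
\<close>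

lemma int_values_prime_power_step:
  fixes P :: "int poly" and z :: complex
  assumes m: "m > 0" and z: "z ^ m = 1" 
    and rat: "\<And>j. poly (map_poly of_int P) (z ^ j) \<in> \<rat>"
    and bound: "\<And>j. norm (poly (map_poly of_int P) (z ^ j)) \<le> B"
    and p: "prime p" "real p > 2 * B"
  shows "poly (map_poly of_int P) (z ^ (j * p)) = poly (map_poly of_int P) (z ^ j)"
proof -
  let ?f = "\<lambda>j. poly (map_poly complex_of_int P) (z ^ j)"
  have zj: "(z ^ j) ^ m = 1" for j by (metis z power_mult mult.commute power_one)
  have "?f j \<in> \<int>" for j
    using rational_algebraic_int_is_int[OF algebraic_int_poly_root_of_unity[OF m zj] rat] .
  then obtain a b where a: "?f j = of_int a" and b: "?f (j * p) = of_int b"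
    by (metis Ints_cases)
  obtain Q where Q: "P ^ p - pcompose P (Polynomial.monom 1 p) = of_nat p * Q"
    using prime_dvd_poly_power_diff[OF p(1), of P] by (auto elim: dvdE)
  define q where "q = poly (map_poly complex_of_int Q) (z ^ j)"
  have "poly (map_poly complex_of_int (P ^ p - pcompose P (Polynomial.monom 1 p))) (z ^ j) = of_nat p * q"
    unfolding Q q_def by (simp add: hom_distribs)
  hence eq: "of_int a ^ p - of_int b = of_nat p * q"
    by (simp add: hom_distribs of_int_poly_hom.hom_power poly_pcompose Polynomial.poly_monom a power_mult b[symmetric])
  hence "q = (of_int a ^ p - of_int b) / of_nat p" using prime_gt_0_nat[OF p(1)] by (simp add: field_simps)
  \<comment> \<open>the quotient by \<open>p\<close> is rational, and being a polynomial value it is again an algebraic integer\<close>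
  hence "q \<in> \<rat>" by simp
  hence "q \<in> \<int>" using rational_algebraic_int_is_int algebraic_int_poly_root_of_unity[OF m zj] q_def by blast
  then obtain c where c: "q = of_int c" by (elim Ints_cases)
  have "complex_of_int (a ^ p - b) = of_int (int p * c)" using eq c by simp
  hence "int p dvd a ^ p - b" unfolding of_int_eq_iff by simp
  hence "int p dvd (a ^ p - b) - (a ^ p - a)" using prime_dvd_int_power_diff[OF p(1), of a] by (rule dvd_diff)
  hence dvd: "int p dvd a - b" by simp
  have "\<bar>real_of_int a\<bar> \<le> B" "\<bar>real_of_int b\<bar> \<le> B" using bound[of j] bound[of "j * p"] a b by simp_all
  hence "\<bar>a - b\<bar> < int p" using p(2) by linarith
  hence "a = b" using dvd zdvd_not_zless[of "\<bar>a - b\<bar>" "int p"] by fastforce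
  thus ?thesis using a b by simp
qed

text \<open>
  The exponent \<open>j\<close> is arbitrary so that the step for one prime can be iterated along the prime
  factorization of \<open>k\<close>.
\<close>

lemma int_values_rough_power:
  fixes P :: "int poly" and z :: complex
  assumes "m > 0" and "z ^ m = 1" 
    and "\<And>j. poly (map_poly of_int P) (z ^ j) \<in> \<rat>"
    and "\<And>j. norm (poly (map_poly of_int P) (z ^ j)) \<le> B"
    and "k > 0" and "\<And>p. prime p \<Longrightarrow> p dvd k \<Longrightarrow> real p > 2 * B"
  shows "poly (map_poly of_int P) (z ^ (j * k)) = poly (map_poly of_int P) (z ^ j)"
  using assms(5,6)
proof (induction k arbitrary: j rule: prime_divisors_induct)
  case (factor p k)
  have "poly (map_poly of_int P) (z ^ (j * (p * k))) = poly (map_poly of_int P) (z ^ (j * p))"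
    using factor.IH[of "j * p"] factor.prems by (simp add: mult_ac)
  also have "\<dots> = poly (map_poly of_int P) (z ^ j)"
    using int_values_prime_power_step[OF assms(1-4) factor.hyps] factor.prems(2)[OF factor.hyps] by simp
  finally show ?case .
qed auto

text \<open>
  Primes dividing \<open>m\<close> cannot divide a number congruent to \<open>k\<close>, and the other primes up to \<open>b\<close> are
  excluded by asking for the residue \<open>1\<close> modulo their product.
\<close>

lemma rough_representative:
  fixes k m b :: nat
  assumes "coprime k m" "m > 0"
  shows "\<exists>k'>0. [k' = k] (mod m) \<and> (\<forall>p. prime p \<longrightarrow> p dvd k' \<longrightarrow> p > b)"
proof -
  define S where "S = {p. prime p \<and> p \<le> b \<and> \<not> p dvd m}"
  define M where "M = \<Prod>S"
  have fin: "finite S" unfolding S_def by simp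
  have "coprime m M" unfolding M_def
    by (rule prod_coprime_right) (auto simp: S_def prime_imp_coprime coprime_commute)
  then obtain x where x: "[x = k] (mod m)" "[x = 1] (mod M)"
    using binary_chinese_remainder_nat by blast
  have M0: "M > 0" unfolding M_def by (rule prod_pos) (auto simp: S_def prime_gt_0_nat)
  \<comment> \<open>the summand \<open>m * M\<close> only serves to make the number positive\<close>
  define k' where "k' = x + m * M"
  have k': "[k' = k] (mod m)" "[k' = 1] (mod M)"
    using x unfolding k'_def cong_def by auto
  have "k' > 0" using M0 assms by (simp add: k'_def)
  moreover have "p > b" if p: "prime p" "p dvd k'" for p
  proof (rule ccontr)
    assume "\<not> p > b"
    show False
    proof (cases "p dvd m")
      case True
      hence "p dvd k" using k'(1) p(2) by (metis cong_dvd_iff cong_dvd_modulus_nat)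
      thus False using True assms p(1) by (meson not_coprimeI not_prime_unit)
    next
      case False
      hence "p \<in> S" using p \<open>\<not> p > b\<close> by (auto simp: S_def)
      hence "p dvd M" unfolding M_def using dvd_prodI[OF fin, of p "\<lambda>x. x"] by simp
      hence "p dvd 1" using k'(2) p(2) by (metis cong_dvd_iff cong_dvd_modulus_nat)
      thus False using p(1) by simp
    qed
  qed
  ultimately show ?thesis using k'(1) by blast
qed

text \<open>
  For primitive \<open>z\<close>, a rational \<open>P(z)\<close> is fixed by the automorphism \<open>z \<mapsto> z\<^sup>k\<close> of the cyclotomic
  field.  Here \<open>k\<close> is replaced by a congruent exponent whose prime factors exceed twice a common bound
  for the values of \<open>P\<close> at the powers of \<open>z\<close>.
\<close>

lemma rational_values_coprime_power:
  fixes P :: "int poly" and z :: complex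
  assumes m: "m > 0" and z: "z ^ m = 1"
    and rat: "\<And>j. poly (map_poly of_int P) (z ^ j) \<in> \<rat>"
    and k: "coprime k m"
  shows "poly (map_poly of_int P) (z ^ k) = poly (map_poly of_int P) z"
proof -
  have pw: "z ^ (i mod m) = z ^ i" for i
    by (rule power_mod_root_of_unity[OF z])
  let ?f = "\<lambda>j. poly (map_poly complex_of_int P) (z ^ j)"
  define B where "B = (\<Sum>j<m. norm (?f j))"
  have bound: "norm (?f j) \<le> B" for j
  proof -
    have "norm (?f (j mod m)) \<le> B" unfolding B_def using m by (intro member_le_sum) auto
    thus ?thesis by (simp only: pw)
  qed
  obtain k' where k': "k' > 0" "[k' = k] (mod m)" "\<And>p. prime p \<Longrightarrow> p dvd k' \<Longrightarrow> p > nat \<lceil>2 * B\<rceil>"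
    using rough_representative[OF k m] by blast
  have "z ^ k = z ^ k'" using k'(2) pw unfolding cong_def by metis
  moreover have "?f (1 * k') = ?f 1"
  proof (rule int_values_rough_power[OF m z rat bound k'(1)])
    fix p assume "prime p" "p dvd k'"
    hence "nat \<lceil>2 * B\<rceil> < p" by (rule k'(3))
    thus "real p > 2 * B" by linarith
  qed
  ultimately show ?thesis by simp
qed

section \<open>Traces of matrix representations\<close>

text \<open>
  The columns of \<open>P\<close> are a basis of \<open>W\<close> followed by a completion to a basis of the whole space; the
  last condition says that vectors of \<open>W\<close> have no coordinates along the completion.
\<close>

lemma (in vec_space) subspace_adapted_basis:
  assumes sub: "VectorSpace.subspace class_ring W V" 
    and nz: "W \<noteq> {0\<^sub>v n}" and nt: "W \<noteq> carrier_vec n"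
  obtains k P Q where "0 < k" "k < n" "P \<in> carrier_mat n n" "Q \<in> carrier_mat n n"
    "P * Q = 1\<^sub>m n" "Q * P = 1\<^sub>m n" "\<And>j. j < k \<Longrightarrow> col P j \<in> W"
    "\<And>w i. w \<in> W \<Longrightarrow> k \<le> i \<Longrightarrow> i < n \<Longrightarrow> (Q *\<^sub>v w) $ i = 0"
proof -
  have mod: "submodule class_ring W V" using sub by (simp add: VectorSpace.subspace_def)
  have Wc: "W \<subseteq> carrier_vec n" using submodule.subset[OF mod] by simp
  obtain A where finA: "finite A" and max: "maximal A (\<lambda>S. S \<subseteq> W \<and> lin_indpt S)"
  proof -
    have "\<exists>A. finite A \<and> maximal A (\<lambda>S. S \<subseteq> W \<and> lin_indpt S)"
    proof (rule maximal_exists[where N = n and B = "{}"])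
      fix S assume "S \<subseteq> W \<and> lin_indpt S"
      thus "finite S \<and> card S \<le> n"
        using li_le_dim[OF fin_dim, of S] Wc dim_is_n by auto
    qed (auto simp: lin_dep_def)
    thus ?thesis using that by blast
  qed
  have AW: "A \<subseteq> W" and li: "lin_indpt A" 
    and mx: "\<And>S. A \<subseteq> S \<Longrightarrow> S \<subseteq> W \<Longrightarrow> lin_indpt S \<Longrightarrow> S = A"
    using max unfolding maximal_def by blast+
  have Ac: "A \<subseteq> carrier_vec n" using AW Wc by blast
  have spanA: "span A = W"
  proof
    show "span A \<subseteq> W" using span_is_subset[OF AW mod] .
    show "W \<subseteq> span A"
    proof
      fix w assume w: "w \<in> W"
      show "w \<in> span A"
      proof (rule ccontr)
        assume n: "w \<notin> span A"
        hence "w \<notin> A" using in_own_span[of A] Ac by auto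
        hence "lin_indpt (A \<union> {w})" using lin_dep_iff_in_span[of A w] n Ac li w Wc by auto
        hence "A \<union> {w} = A" using mx[of "A \<union> {w}"] AW w by blast
        thus False using \<open>w \<notin> A\<close> by blast
      qed
    qed
  qed
  define k where "k = card A"
  have "A \<noteq> {}" using spanA span_empty nz by auto
  hence k0: "0 < k" using finA by (simp add: k_def card_gt_0_iff)
  have kn: "k < n"
  proof (rule ccontr)
    assume "\<not> k < n"
    hence "basis A" using dim_li_is_basis[OF fin_dim finA _ li] Ac dim_is_n by (simp add: k_def)
    thus False using spanA nt by (simp add: basis_def)
  qed
  have cU: "card (set (unit_vecs n :: 'a vec list)) = n" by (simp add: distinct_card[OF unit_vecs_distinct])
  have "A \<subseteq> span (set (unit_vecs n))" using Ac by (simp add: span_unit_vecs_is_carrier)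
  \<comment> \<open>Steinitz exchange against the unit vectors completes the basis of \<open>W\<close>\<close>
  from replacement[OF finA _ _ li this]
  have "\<exists>C. finite C \<and> C \<subseteq> carrier_vec n \<and> C \<subseteq> span (set (unit_vecs n)) \<and> C \<inter> A = {} \<and>
    int (card C) \<le> int n - int (card A) \<and> span (A \<union> C) = span (set (unit_vecs n))"
    by (simp add: unit_vecs_carrier cU)
  then obtain C where C: "finite C" "C \<subseteq> carrier_vec n" "C \<inter> A = {}" 
    "int (card C) \<le> int n - int (card A)" "span (A \<union> C) = span (set (unit_vecs n))"
    by (elim exE conjE)
  have sp: "span (A \<union> C) = carrier_vec n" using C(5) by (simp add: span_unit_vecs_is_carrier)
  have "card (A \<union> C) \<ge> n"
    using gen_ge_dim[of "A \<union> C"] finA C(1,2) Ac sp dim_is_n by simp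
  moreover have "card (A \<union> C) = k + card C" using finA C(1,3) by (simp add: card_Un_disjoint k_def Int_commute)
  ultimately have cC: "k + card C = n" using C(4) k_def by linarith
  obtain ws where ws: "set ws = A" "distinct ws" using finite_distinct_list[OF finA] by blast
  obtain cs where cs: "set cs = C" "distinct cs" using finite_distinct_list[OF C(1)] by blast
  define vs where "vs = ws @ cs"
  have lw: "length ws = k" using ws by (metis distinct_card k_def)
  have lv: "length vs = n" using lw cC cs by (simp add: vs_def) (metis distinct_card)
  have vsc: "set vs \<subseteq> carrier_vec n" using ws cs Ac C(2) by (simp add: vs_def)
  define P where "P = mat_of_cols n vs"
  have P: "P \<in> carrier_mat n n" unfolding P_def by (rule carrier_matI) (simp_all add: lv)
  have dim_cols: "\<forall>w\<in>set us. dim_vec w = n" if "set us \<subseteq> carrier_vec n" for us :: "'a vec list"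
    using that by auto
  have ex: "\<exists>c. x = P *\<^sub>v vec n c" if "x \<in> carrier_vec n" for x
  proof -
    have "x \<in> span_list vs" using that sp span_list_as_span[OF vsc] ws cs by (simp add: vs_def)
    then obtain c where "x = lincomb_list c vs" by (auto simp: span_list_def)
    also have "lincomb_list c vs = P *\<^sub>v vec n c"
      using lincomb_list_as_mat_mult[OF dim_cols[OF vsc], of c] unfolding P_def lv .
    finally show ?thesis by blast
  qed
  have "\<exists>q. \<forall>i. unit_vec n i = P *\<^sub>v vec n (q i)"
    by (rule choice) (blast intro: ex unit_vec_carrier)
  then obtain q where q: "\<And>i. unit_vec n i = P *\<^sub>v vec n (q i)" by blast
  define Q where "Q = mat_of_cols n (map (\<lambda>i. vec n (q i)) [0..<n])"
  have Q: "Q \<in> carrier_mat n n" unfolding Q_def by (rule carrier_matI) simp_all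
  have PQ: "P * Q = 1\<^sub>m n"
  proof (rule mat_col_eqI)
    fix j assume "j < dim_col (1\<^sub>m n :: 'a mat)"
    hence j: "j < n" by simp
    have "col (P * Q) j = P *\<^sub>v col Q j" using col_mult2[OF P Q j] .
    also have "col Q j = vec n (q j)" using j by (simp add: Q_def)
    finally show "col (P * Q) j = col (1\<^sub>m n) j" using q j by simp
  qed (use P Q in auto)
  have QP: "Q * P = 1\<^sub>m n" by (rule mat_mult_left_right_inverse[OF P Q PQ])
  show thesis
  proof (rule that[OF k0 kn P Q PQ QP])
    fix j assume j: "j < k"
    hence "col P j = ws ! j" using lv lw vsc kn by (simp add: P_def vs_def nth_append subset_iff)
    thus "col P j \<in> W" using ws j lw AW by auto
  next
    fix w i assume w: "w \<in> W" and i: "k \<le> i" "i < n"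
    have "w \<in> span_list ws" using w spanA Ac ws span_list_as_span[of ws] by simp
    then obtain c where c: "w = lincomb_list c ws" by (auto simp: span_list_def)
    define d where "d = vec n (\<lambda>i. if i < k then c i else 0)"
    have d: "d \<in> carrier_vec n" by (simp add: d_def)
    have "w = mat_of_cols n ws *\<^sub>v vec k c"
      using lincomb_list_as_mat_mult[OF dim_cols, of ws c] Ac unfolding ws lw c .
    also have "\<dots> = P *\<^sub>v d"
    proof (rule eq_vecI)
      fix r assume "r < dim_vec (P *\<^sub>v d)"
      hence r: "r < n" using P by simp
      have "(P *\<^sub>v d) $ r = (\<Sum>i<n. vs ! i $ r * (if i < k then c i else 0))"
        using r lv by (simp add: P_def d_def scalar_prod_def mat_of_cols_index lessThan_atLeast0)
      also have "\<dots> = (\<Sum>i<k. vs ! i $ r * (if i < k then c i else 0))"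
        using kn by (intro sum.mono_neutral_right) auto
      also have "\<dots> = (\<Sum>i<k. ws ! i $ r * c i)"
        using lw by (intro sum.cong) (auto simp: vs_def nth_append)
      finally show "(mat_of_cols n ws *\<^sub>v vec k c) $ r = (P *\<^sub>v d) $ r"
        using r lw by (simp add: scalar_prod_def mat_of_cols_index lessThan_atLeast0)
    qed (use P in simp)
    finally have "Q *\<^sub>v w = d"
      using assoc_mult_mat_vec[OF Q P d] QP d by simp
    thus "(Q *\<^sub>v w) $ i = 0" using i by (simp add: d_def)
  qed
qed

lemma (in group) hom_GL_iff:
  "\<rho> \<in> hom G (GL n) \<longleftrightarrow> \<rho> \<one> = 1\<^sub>m n \<and> (\<forall>g\<in>carrier G. \<rho> g \<in> carrier_mat n n) \<and>
     (\<forall>g\<in>carrier G. \<forall>h\<in>carrier G. \<rho> (g \<otimes> h) = \<rho> g * \<rho> h)" (is "?L \<longleftrightarrow> ?R")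
proof
  assume L: ?L
  then interpret group_hom G "GL n" \<rho>
    using group_GL by (simp add: group_hom_def group_hom_axioms_def)
  show ?R using hom_one hom_closed hom_mult GL_simps by metis
next
  assume R: ?R
  have "\<rho> g \<in> carrier (GL n)" if g: "g \<in> carrier G" for g
  proof -
    have "\<rho> g * \<rho> (inv g) = 1\<^sub>m n" "\<rho> (inv g) * \<rho> g = 1\<^sub>m n"
      using R g by (metis inv_closed r_inv, metis inv_closed l_inv)
    thus ?thesis using R g by (auto simp: GL_def units_of_def Units_def ring_mat_simps intro!: bexI[of _ "\<rho> (inv g)"])
  qed
  thus ?L using R by (auto simp: hom_def GL_simps)
qed

definition trace_function :: "('a, 'b) monoid_scheme \<Rightarrow> ('a \<Rightarrow> complex mat) \<Rightarrow> 'a \<Rightarrow> complex" where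
  "trace_function G \<rho> = (\<lambda>g. if g \<in> carrier G then mat_trace (\<rho> g) else 0)"

lemma is_character_irr: "\<chi> \<in> Irr G \<Longrightarrow> is_character G \<chi>"
  unfolding is_character_def by (rule exI[of _ "{\<chi>}"], rule exI[of _ "\<lambda>_. 1"]) auto

lemma is_character_add:
  assumes "is_character G \<chi>" "is_character G \<phi>"
  shows "is_character G (\<lambda>g. \<chi> g + \<phi> g)"
proof -
  obtain S m where S: "finite S" "S \<subseteq> Irr G" "\<exists>\<psi>\<in>S. m \<psi> \<noteq> (0::nat)"
    "\<chi> = (\<lambda>g. \<Sum>\<psi>\<in>S. of_nat (m \<psi>) * \<psi> g)" using assms(1) unfolding is_character_def by blast
  obtain T l where T: "finite T" "T \<subseteq> Irr G" "\<exists>\<psi>\<in>T. l \<psi> \<noteq> (0::nat)"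
    "\<phi> = (\<lambda>g. \<Sum>\<psi>\<in>T. of_nat (l \<psi>) * \<psi> g)" using assms(2) unfolding is_character_def by blast
  define r where "r = (\<lambda>\<psi>. (if \<psi> \<in> S then m \<psi> else 0) + (if \<psi> \<in> T then l \<psi> else 0))"
  have "(\<Sum>\<psi>\<in>S \<union> T. of_nat (r \<psi>) * \<psi> g) = \<chi> g + \<phi> g" for g
  proof -
    have "(\<Sum>\<psi>\<in>S \<union> T. of_nat (r \<psi>) * \<psi> g) = (\<Sum>\<psi>\<in>S \<union> T. of_nat (if \<psi> \<in> S then m \<psi> else 0) * \<psi> g)
       + (\<Sum>\<psi>\<in>S \<union> T. of_nat (if \<psi> \<in> T then l \<psi> else 0) * \<psi> g)"
      by (simp add: r_def algebra_simps sum.distrib)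
    also have "(\<Sum>\<psi>\<in>S \<union> T. of_nat (if \<psi> \<in> S then m \<psi> else 0) * \<psi> g) = \<chi> g"
      unfolding S(4) using S(1) T(1) by (intro sum.mono_neutral_cong_right) auto
    also have "(\<Sum>\<psi>\<in>S \<union> T. of_nat (if \<psi> \<in> T then l \<psi> else 0) * \<psi> g) = \<phi> g"
      unfolding T(4) using S(1) T(1) by (intro sum.mono_neutral_cong_right) auto
    finally show ?thesis .
  qed
  moreover have "\<exists>\<psi>\<in>S \<union> T. r \<psi> \<noteq> 0" using S(3) by (auto simp: r_def)
  ultimately show ?thesis unfolding is_character_def using S(1,2) T(1,2)
    by (intro exI[of _ "S \<union> T"] exI[of _ r]) auto
qed

lemma mult_mat_index_sum:
  assumes "A \<in> carrier_mat n m" "B \<in> carrier_mat m l" "i < n" "j < l"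
  shows "(A * B) $$ (i,j) = (\<Sum>r<m. A $$ (i,r) * B $$ (r,j))"
  using assms by (auto simp: scalar_prod_def lessThan_atLeast0 intro!: sum.cong)

lemma sum_lessThan_add:
  fixes f :: "nat \<Rightarrow> 'a::comm_monoid_add"
  shows "(\<Sum>l<k + d. f l) = (\<Sum>l<k. f l) + (\<Sum>l<d. f (l + k))"
  by (induction d) (simp_all add: add.assoc add.commute[of k])

text \<open>
  By induction on the dimension.  In a basis adapted to an invariant subspace all matrices are block
  upper triangular, and both diagonal blocks are representations of smaller dimension.
\<close>

lemma (in group) is_character_trace_function:
  assumes "\<rho> \<in> hom G (GL n)" "n > 0"
  shows "is_character G (trace_function G \<rho>)"
  using assms
proof (induction n arbitrary: \<rho> rule: less_induct)
  case (less n)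
  note rho = less.prems(1)[unfolded hom_GL_iff]
  show ?case
  proof (cases "irreducible_rep G n \<rho>")
    case True
    hence "trace_function G \<rho> \<in> Irr G" by (auto simp: Irr_def trace_function_def)
    thus ?thesis by (rule is_character_irr)
  next
    case False
    interpret vec_space "TYPE(complex)" n .
    obtain W where W: "VectorSpace.subspace class_ring W V" "W \<noteq> {0\<^sub>v n}" "W \<noteq> carrier_vec n"
      and inv: "\<And>g w. g \<in> carrier G \<Longrightarrow> w \<in> W \<Longrightarrow> \<rho> g *\<^sub>v w \<in> W"
      using False less.prems unfolding irreducible_rep_def by blast
    obtain k P Q where k: "0 < k" "k < n" and P: "P \<in> carrier_mat n n" and Q: "Q \<in> carrier_mat n n"
      and PQ: "P * Q = 1\<^sub>m n" and QP: "Q * P = 1\<^sub>m n" and colP: "\<And>j. j < k \<Longrightarrow> col P j \<in> W"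
      and low: "\<And>w i. w \<in> W \<Longrightarrow> k \<le> i \<Longrightarrow> i < n \<Longrightarrow> (Q *\<^sub>v w) $ i = 0"
      by (rule subspace_adapted_basis[OF W]) blast
    define M where "M g = Q * (\<rho> g * P)" for g
    have R: "\<rho> g \<in> carrier_mat n n" if "g \<in> carrier G" for g using rho that by blast
    have M: "M g \<in> carrier_mat n n" if "g \<in> carrier G" for g
      using P Q R[OF that] by (simp add: M_def)
    have M1: "M \<one> = 1\<^sub>m n" using rho P QP by (simp add: M_def)
    have Mm: "M (g \<otimes> h) = M g * M h" if g: "g \<in> carrier G" and h: "h \<in> carrier G" for g h
    proof -
      have "M g * M h = Q * (\<rho> g * (P * Q) * (\<rho> h * P))"
        using P Q R[OF g] R[OF h] by (simp add: M_def assoc_mult_mat[of _ n n _ n _ n])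
      also have "\<dots> = M (g \<otimes> h)"
        using P Q R[OF g] R[OF h] rho g h by (simp add: M_def PQ right_mult_one_mat[OF R[OF g]] assoc_mult_mat[of _ n n _ n _ n])
      finally show ?thesis by simp
    qed
    \<comment> \<open>invariance of \<open>W\<close> makes the lower left block vanish\<close>
    have M0: "M g $$ (i, j) = 0" if g: "g \<in> carrier G" and ij: "k \<le> i" "i < n" "j < k" for g i j
    proof -
      have "M g $$ (i, j) = col (M g) j $ i" using M[OF g] ij k by simp
      also have "col (M g) j = Q *\<^sub>v (\<rho> g *\<^sub>v col P j)"
        using P Q R[OF g] ij k col_mult2[of Q n n "\<rho> g * P" n j] col_mult2[of "\<rho> g" n n P n j] by (simp add: M_def)
      finally show ?thesis using low[OF inv[OF g colP]] ij by simp
    qed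
    have tr: "mat_trace (M g) = mat_trace (\<rho> g)" if g: "g \<in> carrier G" for g
    proof -
      have "mat_trace (M g) = mat_trace ((\<rho> g * P) * Q)"
        unfolding M_def using P Q R[OF g] by (intro mat_trace_mult_comm[where n = n]) auto
      also have "(\<rho> g * P) * Q = \<rho> g * (P * Q)"
        using P Q R[OF g] by (simp add: assoc_mult_mat[of _ n n _ n _ n])
      finally show ?thesis using PQ R[OF g] by simp
    qed
    define A where "A g = mat k k (\<lambda>(i,j). M g $$ (i,j))" for g
    define D where "D g = mat (n - k) (n - k) (\<lambda>(i,j). M g $$ (i + k,j + k))" for g
    have split: "(\<Sum>l<n. f l) = (\<Sum>l<k. f l) + (\<Sum>l<n - k. f (l + k))" for f :: "nat \<Rightarrow> complex"
      using sum_lessThan_add[of f k "n - k"] k by simp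
    have "A \<in> hom G (GL k)" unfolding hom_GL_iff
    proof (intro conjI ballI)
      show "A \<one> = 1\<^sub>m k" using k by (auto simp: A_def M1)
      fix g h assume g: "g \<in> carrier G" and h: "h \<in> carrier G"
      show "A (g \<otimes> h) = A g * A h"
      proof (rule eq_matI)
        fix i j assume "i < dim_row (A g * A h)" "j < dim_col (A g * A h)"
        hence ij: "i < k" "j < k" by (simp_all add: A_def)
        have "(A g * A h) $$ (i,j) = (\<Sum>r<k. M g $$ (i,r) * M h $$ (r,j))"
          using ij by (subst mult_mat_index_sum[of _ k k _ k]) (auto simp: A_def)
        also have "\<dots> = (\<Sum>r<n. M g $$ (i,r) * M h $$ (r,j))"
          unfolding split using ij k M0[OF h] by simp
        also have "\<dots> = M (g \<otimes> h) $$ (i,j)"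
          unfolding Mm[OF g h] using ij k M[OF g] M[OF h] by (subst mult_mat_index_sum[of _ n n _ n]) auto
        finally show "A (g \<otimes> h) $$ (i,j) = (A g * A h) $$ (i,j)" using ij by (simp add: A_def)
      qed (simp_all add: A_def)
    qed (simp add: A_def)
    hence chA: "is_character G (trace_function G A)" using less.IH k by blast
    have "D \<in> hom G (GL (n - k))" unfolding hom_GL_iff
    proof (intro conjI ballI)
      show "D \<one> = 1\<^sub>m (n - k)" using k by (auto simp: D_def M1)
      fix g h assume g: "g \<in> carrier G" and h: "h \<in> carrier G"
      show "D (g \<otimes> h) = D g * D h"
      proof (rule eq_matI)
        fix i j assume "i < dim_row (D g * D h)" "j < dim_col (D g * D h)"
        hence ij: "i < n - k" "j < n - k" by (simp_all add: D_def)
        have "(D g * D h) $$ (i,j) = (\<Sum>r<n - k. M g $$ (i + k,r + k) * M h $$ (r + k,j + k))"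
          using ij by (subst mult_mat_index_sum[of _ "n - k" "n - k" _ "n - k"]) (auto simp: D_def)
        also have "\<dots> = (\<Sum>r<n. M g $$ (i + k,r) * M h $$ (r,j + k))"
          unfolding split using ij k M0[OF g] by simp
        also have "\<dots> = M (g \<otimes> h) $$ (i + k,j + k)"
          unfolding Mm[OF g h] using ij k M[OF g] M[OF h] by (subst mult_mat_index_sum[of _ n n _ n]) auto
        finally show "D (g \<otimes> h) $$ (i,j) = (D g * D h) $$ (i,j)" using ij by (simp add: D_def)
      qed (simp_all add: D_def)
    qed (simp add: D_def)
    hence chD: "is_character G (trace_function G D)" using less.IH[of "n - k"] k by simp
    have "trace_function G \<rho> = (\<lambda>g. trace_function G A g + trace_function G D g)"
    proof
      fix g
      show "trace_function G \<rho> g = trace_function G A g + trace_function G D g"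
      proof (cases "g \<in> carrier G")
        case True
        have "mat_trace (\<rho> g) = (\<Sum>i<n. M g $$ (i,i))"
          using tr[OF True] M[OF True] unfolding mat_trace_def by (metis carrier_matD(1))
        also have "\<dots> = mat_trace (A g) + mat_trace (D g)"
          unfolding split by (simp add: mat_trace_def A_def D_def)
        finally show ?thesis using True by (simp add: trace_function_def)
      qed (simp add: trace_function_def)
    qed
    thus ?thesis using is_character_add[OF chA chD] by simp
  qed
qed

section \<open>Rational valued characters on generators of cyclic subgroups\<close>

lemma upper_triangular_mult:
  fixes X Y :: "'a::semiring_1 mat"
  assumes X: "X \<in> carrier_mat n n" "upper_triangular X" and Y: "Y \<in> carrier_mat n n" "upper_triangular Y"
  shows "upper_triangular (X * Y)" "i < n \<Longrightarrow> (X * Y) $$ (i,i) = X $$ (i,i) * Y $$ (i,i)"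
proof -
  have X0: "X $$ (i,j) = 0" if "j < i" "i < n" for i j using X that by auto
  have Y0: "Y $$ (i,j) = 0" if "j < i" "i < n" for i j using Y that by auto
  show "upper_triangular (X * Y)"
  proof (rule upper_triangularI)
    fix i j assume ij: "j < i" "i < dim_row (X * Y)"
    hence i: "i < n" using X by simp
    have "(X * Y) $$ (i,j) = (\<Sum>r<n. X $$ (i,r) * Y $$ (r,j))"
      using ij i X Y by (intro mult_mat_index_sum[of _ n n _ n]) auto
    also have "\<dots> = 0"
    proof (rule sum.neutral, rule ballI)
      fix r assume "r \<in> {..<n}"
      thus "X $$ (i,r) * Y $$ (r,j) = 0" using X0[of r i] Y0[of j r] ij i by (cases "r < i") auto
    qed
    finally show "(X * Y) $$ (i,j) = 0" .
  qed
  assume i: "i < n"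
  have "(X * Y) $$ (i,i) = (\<Sum>r<n. X $$ (i,r) * Y $$ (r,i))"
    using i X Y by (intro mult_mat_index_sum[of _ n n _ n]) auto
  also have "\<dots> = (\<Sum>r\<in>{i}. X $$ (i,r) * Y $$ (r,i))"
  proof (rule sum.mono_neutral_right)
    show "\<forall>r\<in>{..<n} - {i}. X $$ (i,r) * Y $$ (r,i) = 0"
    proof
      fix r assume "r \<in> {..<n} - {i}"
      thus "X $$ (i,r) * Y $$ (r,i) = 0" using X0[of r i] Y0[of i r] i by (cases "r < i") auto
    qed
  qed (use i in auto)
  finally show "(X * Y) $$ (i,i) = X $$ (i,i) * Y $$ (i,i)" by simp
qed

lemma upper_triangular_pow:
  fixes X :: "'a::comm_ring_1 mat"
  assumes X: "X \<in> carrier_mat n n" "upper_triangular X"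
  shows "upper_triangular (X ^\<^sub>m k) \<and> (\<forall>i<n. (X ^\<^sub>m k) $$ (i,i) = (X $$ (i,i)) ^ k)"
proof (induction k)
  case 0
  show ?case using X by auto
next
  case (Suc k)
  have Xk: "X ^\<^sub>m k \<in> carrier_mat n n" using X by simp
  show ?case
    using upper_triangular_mult[OF Xk conjunct1[OF Suc] X] Suc by (simp add: mult.commute)
qed

text \<open>
  The \<open>b i\<close> are the eigenvalues of \<open>A\<close> with multiplicity, read off from the diagonal of a Schur
  triangularization, which simultaneously triangularizes all powers of \<open>A\<close>.
\<close>

lemma power_traces_finite_order_matrix:
  fixes A :: "complex mat"
  assumes A: "A \<in> carrier_mat n n" and m: "A ^\<^sub>m m = 1\<^sub>m n"
  shows "\<exists>b. (\<forall>i<n. b i ^ m = 1) \<and> (\<forall>j. mat_trace (A ^\<^sub>m j) = (\<Sum>i<n. b i ^ j))"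
proof -
  obtain es where "char_poly A = (\<Prod>a\<leftarrow>es. [:- a, 1:])" using char_poly_factorized[OF A] by blast
  then obtain B where B: "B \<in> carrier_mat n n" "upper_triangular B" and sim: "similar_mat A B"
    using schur_decomposition_exists[OF A] by blast
  obtain P Q where wit: "similar_mat_wit A B P Q" using sim unfolding similar_mat_def by blast
  note PQ = similar_mat_witD2[OF A wit]
  have Bp: "B ^\<^sub>m k \<in> carrier_mat n n" for k using B by simp
  have "mat_trace (A ^\<^sub>m j) = (\<Sum>i<n. (B $$ (i,i)) ^ j)" for j
  proof -
    have "mat_trace (A ^\<^sub>m j) = mat_trace (P * (B ^\<^sub>m j * Q))"
      using similar_mat_wit_pow_id[OF wit, of j] PQ(6,7) Bp[of j] by (simp add: assoc_mult_mat[of _ n n _ n _ n])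
    also have "\<dots> = mat_trace ((B ^\<^sub>m j * Q) * P)"
      using PQ(6,7) Bp[of j] by (intro mat_trace_mult_comm[where n = n]) auto
    also have "(B ^\<^sub>m j * Q) * P = B ^\<^sub>m j"
      using PQ(2,6,7) Bp[of j] by (simp add: right_mult_one_mat[OF Bp] assoc_mult_mat[of _ n n _ n _ n])
    also have "mat_trace (B ^\<^sub>m j) = (\<Sum>i<n. (B $$ (i,i)) ^ j)"
      using upper_triangular_pow[OF B, of j] carrier_matD(1)[OF Bp[of j]] by (simp add: mat_trace_def del: pow_mat_dim)
    finally show ?thesis .
  qed
  moreover have "(B $$ (i,i)) ^ m = 1" if i: "i < n" for i
  proof -
    have "B ^\<^sub>m m = Q * A ^\<^sub>m m * P" using similar_mat_wit_pow_id[OF similar_mat_wit_sym[OF wit]] .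
    also have "\<dots> = 1\<^sub>m n" using PQ(2,6,7) by (simp add: m)
    finally have "(B ^\<^sub>m m) $$ (i,i) = 1" using i by simp
    thus ?thesis using upper_triangular_pow[OF B, of m] i by simp
  qed
  ultimately show ?thesis by (intro exI[of _ "\<lambda>i. B $$ (i,i)"]) blast
qed

lemma (in group) hom_GL_pow:
  assumes rho: "\<rho> \<in> hom G (GL n)" and x: "x \<in> carrier G"
  shows "\<rho> (x [^] (j::nat)) = \<rho> x ^\<^sub>m j"
proof (induction j)
  case 0
  have "dim_row (\<rho> x) = n" using rho x unfolding hom_GL_iff by auto
  thus ?case using rho unfolding hom_GL_iff by simp
next
  case (Suc j)
  thus ?case using rho x unfolding hom_GL_iff by simp
qed

text \<open>
  Each eigenvalue is a power of the primitive root \<open>cis (2 * pi / m)\<close>, and \<open>P\<close> is the sum of the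
  corresponding monomials; one \<open>P\<close> serves for all powers of \<open>x\<close>.
\<close>

lemma (in group) Irr_values_poly_root_of_unity:
  assumes chi: "\<chi> \<in> Irr G" and x: "x \<in> carrier G" and m: "m > 0" "x [^] (m::nat) = \<one>"
  shows "\<exists>P. \<forall>j::nat. \<chi> (x [^] j) = poly (map_poly of_int P) (cis (2 * pi / m) ^ j)"
proof -
  define z where "z = cis (2 * pi / m)"
  obtain n \<rho> where rho: "\<rho> \<in> hom G (GL n)"
    and \<chi>: "\<chi> = (\<lambda>g. if g \<in> carrier G then mat_trace (\<rho> g) else 0)"
    using chi unfolding Irr_def irreducible_rep_def by blast
  have A: "\<rho> x \<in> carrier_mat n n" using rho x unfolding hom_GL_iff by blast
  have "\<rho> x ^\<^sub>m m = 1\<^sub>m n" using hom_GL_pow[OF rho x, of m] m rho unfolding hom_GL_iff by simp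
  then obtain b where b: "\<And>i. i < n \<Longrightarrow> b i ^ m = 1"
    and tr: "\<And>j. mat_trace (\<rho> x ^\<^sub>m j) = (\<Sum>i<n. b i ^ j)"
    using power_traces_finite_order_matrix[OF A] by blast
  have "\<exists>a. b i = z ^ a" if i: "i < n" for i
  proof -
    have "b i \<in> {w. w ^ m = 1}" using b[OF i] by simp
    also have "{w. w ^ m = 1} = (\<lambda>k. cis (2 * pi * real k / real m)) ` {..<m}"
      using bij_betw_roots_unity[OF m(1)] by (simp add: bij_betw_def)
    finally obtain k where "b i = cis (2 * pi * real k / real m)" by blast
    also have "\<dots> = z ^ k" unfolding z_def Complex.DeMoivre by (simp add: field_simps)
    finally show ?thesis by blast
  qed
  then obtain a where a: "\<And>i. i < n \<Longrightarrow> b i = z ^ a i" by metis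
  define P where "P = (\<Sum>i<n. Polynomial.monom (1::int) (a i))"
  have "\<chi> (x [^] j) = poly (map_poly of_int P) (z ^ j)" for j
  proof -
    have "\<chi> (x [^] j) = (\<Sum>i<n. b i ^ j)" using x by (simp add: \<chi> hom_GL_pow[OF rho x] tr)
    also have "\<dots> = (\<Sum>i<n. (z ^ j) ^ a i)"
      by (rule sum.cong) (simp_all add: a mult.commute flip: power_mult)
    also have "\<dots> = poly (map_poly of_int P) (z ^ j)"
      by (simp add: P_def hom_distribs poly_sum Polynomial.poly_monom)
    finally show ?thesis .
  qed
  thus ?thesis unfolding z_def by blast
qed

lemma (in group) character_values_poly_root_of_unity:
  assumes chi: "is_character G \<chi>" and x: "x \<in> carrier G" and m: "m > 0" "x [^] (m::nat) = \<one>"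
  shows "\<exists>P. \<forall>j::nat. \<chi> (x [^] j) = poly (map_poly of_int P) (cis (2 * pi / m) ^ j)"
proof -
  obtain S l where S: "S \<subseteq> Irr G" and \<chi>: "\<chi> = (\<lambda>g. \<Sum>\<psi>\<in>S. of_nat (l \<psi>) * \<psi> g)"
    using chi unfolding is_character_def by blast
  have "\<forall>\<psi>\<in>S. \<exists>P. \<forall>j::nat. \<psi> (x [^] j) = poly (map_poly of_int P) (cis (2 * pi / m) ^ j)"
    using Irr_values_poly_root_of_unity[OF _ x m] S by blast
  then obtain P where P: "\<And>\<psi> j. \<psi> \<in> S \<Longrightarrow> \<psi> (x [^] (j::nat)) = poly (map_poly of_int (P \<psi>)) (cis (2 * pi / m) ^ j)"
    by metis
  have "\<chi> (x [^] j) = poly (map_poly of_int (\<Sum>\<psi>\<in>S. of_nat (l \<psi>) * P \<psi>)) (cis (2 * pi / m) ^ j)" for j :: nat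
    by (simp add: \<chi> P hom_distribs poly_sum)
  thus ?thesis by blast
qed

text \<open>
  These are the class functions constant on Galois classes, the unions of conjugacy classes that are
  linked by \<open>x \<mapsto> x\<^sup>k\<close> with \<open>k\<close> prime to the order of \<open>x\<close>.
\<close>

definition rational_class_functions :: "('a, 'b) monoid_scheme \<Rightarrow> ('a \<Rightarrow> complex) set" where
  "rational_class_functions G = {f \<in> class_functions G. \<forall>x\<in>carrier G. \<forall>y\<in>carrier G.
     generate G {x} = generate G {y} \<longrightarrow> f x = f y}"

lemma subspace_rational_class_functions: "cfun.subspace (rational_class_functions G)"
proof (rule cfun.subspaceI)
  show "0 \<in> rational_class_functions G"
    using cfun.subspace_0[OF subspace_class_functions[of G]] by (simp add: rational_class_functions_def)
next
  fix f h assume f: "f \<in> rational_class_functions G" and h: "h \<in> rational_class_functions G"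
  have "f + h \<in> class_functions G"
    using f h cfun.subspace_add[OF subspace_class_functions[of G]] by (simp add: rational_class_functions_def)
  moreover have "(f + h) x = (f + h) y"
    if "x \<in> carrier G" "y \<in> carrier G" "generate G {x} = generate G {y}" for x y
  proof -
    have "f x = f y" "h x = h y" using f h that unfolding rational_class_functions_def by blast+
    thus ?thesis by simp
  qed
  ultimately show "f + h \<in> rational_class_functions G" unfolding rational_class_functions_def by blast
next
  fix c f assume f: "f \<in> rational_class_functions G"
  have "(\<lambda>x. c * f x) \<in> class_functions G"
    using f cfun.subspace_scale[OF subspace_class_functions[of G]] by (simp add: rational_class_functions_def)
  moreover have "c * f x = c * f y"
    if "x \<in> carrier G" "y \<in> carrier G" "generate G {x} = generate G {y}" for x y
  proof -
    have "f x = f y" using f that unfolding rational_class_functions_def by blast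
    thus ?thesis by simp
  qed
  ultimately show "(\<lambda>x. c * f x) \<in> rational_class_functions G" unfolding rational_class_functions_def by blast
qed

text \<open>
  Two generators of a cyclic subgroup are powers of each other with exponents prime to the order,
  which reduces the claim to the values of one integer polynomial at powers of one root of unity.
\<close>

lemma (in group) rational_character_constant_on_generators:
  assumes fin: "finite (carrier G)" and chi: "is_character G \<chi>" "rational_valued G \<chi>"
    and x: "x \<in> carrier G" and y: "y \<in> carrier G" and gen: "generate G {x} = generate G {y}"
  shows "\<chi> x = \<chi> y"
proof -
  have m: "ord x > 0" "x [^] ord x = \<one>" using ord_ge_1[OF fin x] x by auto
  have "y \<in> generate G {x}" using gen by (simp add: generate.incl)
  then obtain k :: nat where k: "y = x [^] k"
    using generate_pow_on_finite_carrier[OF fin x] by blast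
  have "ord y = ord x" using generate_pow_card x y gen by simp
  hence co: "coprime k (ord x)" using pow_ord_eq_ord_iff[OF fin x, of k] k by simp
  define z where "z = cis (2 * pi / ord x)"
  obtain P where P: "\<And>j::nat. \<chi> (x [^] j) = poly (map_poly of_int P) (z ^ j)"
    using character_values_poly_root_of_unity[OF chi(1) x m] unfolding z_def by blast
  have "poly (map_poly of_int P) (z ^ k) = poly (map_poly of_int P) z"
  proof (rule rational_values_coprime_power[OF m(1) _ _ co])
    show "z ^ ord x = 1" using m(1) by (simp add: z_def Complex.DeMoivre)
    fix j
    show "poly (map_poly of_int P) (z ^ j) \<in> \<rat>"
      using chi(2) x unfolding rational_valued_def by (simp flip: P)
  qed
  thus ?thesis using P[of k] P[of 1] k x by simp
qed

lemma (in group) rational_character_span_subset: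
  assumes "finite (carrier G)"
  shows "rational_character_span G \<subseteq> rational_class_functions G"
  unfolding rational_character_span_def
proof (rule cfun.span_minimal[OF _ subspace_rational_class_functions], safe)
  fix \<chi> assume chi: "is_character G \<chi>" "rational_valued G \<chi>"
  hence "\<chi> \<in> rational_character_span G"
    unfolding rational_character_span_def by (intro cfun.span_base) simp
  hence "\<chi> \<in> class_functions G" using rational_character_span_class_functions by blast
  thus "\<chi> \<in> rational_class_functions G"
    unfolding rational_class_functions_def
    using rational_character_constant_on_generators[OF assms chi] by blast
qed

section \<open>Characters induced from principal characters\<close>

context group
begin

lemma induced_principal_character:
  assumes fin: "finite (carrier G)" and g: "g \<in> carrier G"
  shows "induced G H (principal_character H) g =
    of_nat (card {x \<in> carrier G. x \<otimes> g \<otimes> inv x \<in> H}) / of_nat (card H)"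
proof -
  have "(\<Sum>x\<in>carrier G. let y = x \<otimes> g \<otimes> inv x in if y \<in> H then principal_character H y else 0) =
    (\<Sum>x\<in>carrier G. if x \<otimes> g \<otimes> inv x \<in> H then 1 else (0::complex))"
    by (rule sum.cong) (simp_all add: principal_character_def Let_def)
  also have "\<dots> = of_nat (card {x \<in> carrier G. x \<otimes> g \<otimes> inv x \<in> H})"
    by (simp add: fin flip: sum.inter_filter)
  finally show ?thesis using g by (simp add: induced_def)
qed

lemma r_coset_fixed_iff:
  assumes H: "subgroup H G" and g: "g \<in> carrier G" and x: "x \<in> carrier G"
  shows "H #> x #> g = H #> x \<longleftrightarrow> x \<otimes> g \<otimes> inv x \<in> H"
proof -
  have Hc: "H \<subseteq> carrier G" using subgroup.subset[OF H] .
  have eq: "H #> x #> g = H #> (x \<otimes> g)" using coset_mult_assoc[OF Hc x g] .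
  show ?thesis
  proof
    assume "H #> x #> g = H #> x"
    hence "x \<otimes> g \<in> H #> x" using eq rcos_self[OF _ H, of "x \<otimes> g"] x g by simp
    then obtain h where h: "h \<in> H" "x \<otimes> g = h \<otimes> x" by (auto simp: r_coset_def)
    have "x \<otimes> g \<otimes> inv x = h" using h Hc x by (auto simp: m_assoc)
    thus "x \<otimes> g \<otimes> inv x \<in> H" using h by simp
  next
    assume a: "x \<otimes> g \<otimes> inv x \<in> H"
    have "(x \<otimes> g \<otimes> inv x) \<otimes> x \<in> H #> x" using a Hc x by (rule rcosI)
    also have "(x \<otimes> g \<otimes> inv x) \<otimes> x = x \<otimes> g" using x g by (simp add: m_assoc)
    finally show "H #> x #> g = H #> x" using repr_independence[OF _ x H] eq by metis
  qed
qed

text \<open>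
  The elements counted by the induction formula form the union of the fixed cosets, each of which
  has \<open>card H\<close> elements.
\<close>

lemma induced_principal_character_fixed_cosets:
  assumes fin: "finite (carrier G)" and H: "subgroup H G" and g: "g \<in> carrier G"
  shows "induced G H (principal_character H) g = of_nat (card {M \<in> rcosets H. M #> g = M})"
proof -
  have Hc: "H \<subseteq> carrier G" using subgroup.subset[OF H] .
  have finH: "finite H" using Hc fin finite_subset by blast
  have cH: "card H > 0" using finH subgroup.one_closed[OF H] by (auto simp: card_gt_0_iff)
  let ?F = "{M \<in> rcosets H. M #> g = M}"
  have "{x \<in> carrier G. x \<otimes> g \<otimes> inv x \<in> H} = \<Union>?F"
  proof (intro equalityI subsetI)
    fix x assume "x \<in> {x \<in> carrier G. x \<otimes> g \<otimes> inv x \<in> H}"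
    hence x: "x \<in> carrier G" "x \<otimes> g \<otimes> inv x \<in> H" by auto
    hence "H #> x #> g = H #> x" using r_coset_fixed_iff[OF H g] by simp
    thus "x \<in> \<Union>?F" using rcosetsI[OF Hc x(1)] rcos_self[OF x(1) H] by blast
  next
    fix x assume "x \<in> \<Union>?F"
    then obtain M where M: "M \<in> rcosets H" "M #> g = M" "x \<in> M" by blast
    have x: "x \<in> carrier G" using rcosets_part_G[OF H] M by blast
    obtain a where a: "a \<in> carrier G" "M = H #> a" using M(1) by (auto simp: RCOSETS_def)
    have "M = H #> x" using repr_independence[OF _ a(1) H] M(3) a(2) by blast
    thus "x \<in> {x \<in> carrier G. x \<otimes> g \<otimes> inv x \<in> H}" using r_coset_fixed_iff[OF H g x] M(2) x by simp
  qed
  also have "card (\<Union>?F) = (\<Sum>M\<in>?F. card M)"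
  proof (rule card_Union_disjoint)
    show "pairwise disjnt ?F" using rcos_disjoint[OF H] by (rule pairwise_subset) auto
    fix M assume "M \<in> ?F"
    thus "finite M" using rcosets_finite Hc finH by blast
  qed
  also have "\<dots> = (\<Sum>M\<in>?F. card H)" by (rule sum.cong) (auto simp: card_rcosets_equal[OF _ Hc])
  finally show ?thesis using induced_principal_character[OF fin g, of H] cH by simp
qed

lemma rational_valued_induced_principal_character:
  assumes "finite (carrier G)"
  shows "rational_valued G (induced G H (principal_character H))"
  using assms by (simp add: rational_valued_def induced_principal_character)

text \<open>
  The induced character is the trace of the permutation representation on the right cosets of \<open>H\<close>.
\<close>

lemma is_character_induced_principal_character:
  assumes fin: "finite (carrier G)" and H: "subgroup H G"
  shows "is_character G (induced G H (principal_character H))"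
proof -
  have Hc: "H \<subseteq> carrier G" using subgroup.subset[OF H] .
  define N where "N = card (rcosets H)"
  have "finite (rcosets H)" using fin by (simp add: RCOSETS_def)
  then obtain c where c: "bij_betw c {..<N} (rcosets H)"
    using ex_bij_betw_nat_finite unfolding N_def lessThan_atLeast0 by blast
  have N0: "N > 0"
    using \<open>finite (rcosets H)\<close> rcosetsI[OF Hc one_closed] by (auto simp: N_def card_gt_0_iff)
  have cin: "c i \<in> rcosets H" if "i < N" for i using c that by (auto simp: bij_betw_def)
  have cinj: "c i = c j \<longleftrightarrow> i = j" if "i < N" "j < N" for i j
    using c that by (auto simp: bij_betw_def inj_on_def)
  have csub: "c i \<subseteq> carrier G" if "i < N" for i using rcosets_part_G[OF H] cin[OF that] by blast
  have act: "M #> g \<in> rcosets H" if M: "M \<in> rcosets H" and g: "g \<in> carrier G" for M g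
  proof -
    obtain a where "a \<in> carrier G" "M = H #> a" using M by (auto simp: RCOSETS_def)
    thus ?thesis using coset_mult_assoc[OF Hc _ g, of a] rcosetsI[OF Hc, of "a \<otimes> g"] g by simp
  qed
  \<comment> \<open>rows are indexed by the source coset, which turns the right action into a homomorphism\<close>
  define \<rho> where "\<rho> g = mat N N (\<lambda>(i,j). if c i #> g = c j then 1 else (0::complex))" for g
  have "\<rho> \<in> hom G (GL N)" unfolding hom_GL_iff
  proof (intro conjI ballI)
    show "\<rho> \<one> = 1\<^sub>m N"
      by (rule eq_matI) (auto simp: \<rho>_def csub cinj)
    fix g h assume g: "g \<in> carrier G" and h: "h \<in> carrier G"
    show "\<rho> (g \<otimes> h) = \<rho> g * \<rho> h"
    proof (rule eq_matI)
      fix i j assume "i < dim_row (\<rho> g * \<rho> h)" "j < dim_col (\<rho> g * \<rho> h)"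
      hence i: "i < N" and j: "j < N" by (simp_all add: \<rho>_def)
      have "c i #> g \<in> c ` {..<N}" using act[OF cin[OF i] g] c by (simp add: bij_betw_def)
      then obtain l where l: "l < N" "c i #> g = c l" by auto
      have "(\<rho> g * \<rho> h) $$ (i,j) = (\<Sum>r<N. \<rho> g $$ (i,r) * \<rho> h $$ (r,j))"
        using i j by (intro mult_mat_index_sum[of _ N N _ N]) (auto simp: \<rho>_def)
      also have "\<dots> = (\<Sum>r<N. if r = l then \<rho> h $$ (r,j) else 0)"
        using i l by (intro sum.cong) (auto simp: \<rho>_def cinj)
      also have "\<dots> = \<rho> h $$ (l,j)" using l by simp
      also have "\<dots> = \<rho> (g \<otimes> h) $$ (i,j)"
        using l i j coset_mult_assoc[OF csub[OF i] g h] by (simp add: \<rho>_def)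
      finally show "\<rho> (g \<otimes> h) $$ (i,j) = (\<rho> g * \<rho> h) $$ (i,j)" by simp
    qed (simp_all add: \<rho>_def)
  qed (simp add: \<rho>_def)
  hence "is_character G (trace_function G \<rho>)" using N0 by (rule is_character_trace_function)
  also have "trace_function G \<rho> = induced G H (principal_character H)"
  proof
    fix g
    show "trace_function G \<rho> g = induced G H (principal_character H) g"
    proof (cases "g \<in> carrier G")
      case True
      have "mat_trace (\<rho> g) = (\<Sum>i<N. if c i #> g = c i then 1 else 0)"
        by (simp add: mat_trace_def \<rho>_def)
      also have "\<dots> = (\<Sum>M\<in>rcosets H. if M #> g = M then 1 else 0)"
        by (rule sum.reindex_bij_betw[OF c, of "\<lambda>M. if M #> g = M then 1 else 0"])
      also have "\<dots> = of_nat (card {M \<in> rcosets H. M #> g = M})"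
        using \<open>finite (rcosets H)\<close> by (simp flip: sum.inter_filter)
      finally show ?thesis
        using True induced_principal_character_fixed_cosets[OF fin H True] by (simp add: trace_function_def)
    qed (simp add: trace_function_def induced_def)
  qed
  finally show ?thesis .
qed

lemma induced_principal_character_in_span:
  assumes "finite (carrier G)" and "subgroup H G"
  shows "induced G H (principal_character H) \<in> rational_character_span G"
  unfolding rational_character_span_def
  using is_character_induced_principal_character[OF assms]
    rational_valued_induced_principal_character[OF assms(1)] by (intro cfun.span_base) blast

end

section \<open>Conjugation and cyclic subgroups\<close>

context group
begin

lemma conjugation_hom:
  assumes g: "g \<in> carrier G"
  shows "group_hom G G (\<lambda>x. g \<otimes> x \<otimes> inv g)"
proof -
  have "g \<otimes> (x \<otimes> y) \<otimes> inv g = (g \<otimes> x \<otimes> inv g) \<otimes> (g \<otimes> y \<otimes> inv g)"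
    if x: "x \<in> carrier G" and y: "y \<in> carrier G" for x y
  proof -
    have "(g \<otimes> x \<otimes> inv g) \<otimes> (g \<otimes> y \<otimes> inv g) = g \<otimes> x \<otimes> (inv g \<otimes> g) \<otimes> y \<otimes> inv g"
      using g x y by (simp only: m_assoc m_closed inv_closed)
    also have "\<dots> = g \<otimes> (x \<otimes> y) \<otimes> inv g" using g x y by (simp add: m_assoc)
    finally show ?thesis by simp
  qed
  thus ?thesis using g by (intro group_hom.intro group_hom_axioms.intro homI is_group) auto
qed

lemma conjugation_cancel:
  assumes "g \<in> carrier G" "x \<in> carrier G"
  shows "inv g \<otimes> (g \<otimes> x \<otimes> inv g) \<otimes> g = x" "g \<otimes> (inv g \<otimes> x \<otimes> g) \<otimes> inv g = x"
proof -
  have "inv g \<otimes> (g \<otimes> x \<otimes> inv g) \<otimes> g = (inv g \<otimes> g) \<otimes> x \<otimes> (inv g \<otimes> g)"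
    using assms by (simp only: m_assoc m_closed inv_closed)
  thus "inv g \<otimes> (g \<otimes> x \<otimes> inv g) \<otimes> g = x" using assms by simp
  have "g \<otimes> (inv g \<otimes> x \<otimes> g) \<otimes> inv g = (g \<otimes> inv g) \<otimes> x \<otimes> (g \<otimes> inv g)"
    using assms by (simp only: m_assoc m_closed inv_closed)
  thus "g \<otimes> (inv g \<otimes> x \<otimes> g) \<otimes> inv g = x" using assms by simp
qed

lemma inj_on_conjugation:
  assumes g: "g \<in> carrier G"
  shows "inj_on (\<lambda>x. g \<otimes> x \<otimes> inv g) (carrier G)"
  by (rule inj_on_inverseI[of _ "\<lambda>x. inv g \<otimes> x \<otimes> g"]) (rule conjugation_cancel(1)[OF g])

lemma conjugate_set_eq_image: "g <# C #> inv g = (\<lambda>x. g \<otimes> x \<otimes> inv g) ` C"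
  by (auto simp: l_coset_def r_coset_def)

lemma generate_conjugate:
  assumes g: "g \<in> carrier G" and x: "x \<in> carrier G"
  shows "generate G {g \<otimes> x \<otimes> inv g} = g <# generate G {x} #> inv g"
  using group_hom.generate_img[OF conjugation_hom[OF g], of "{x}"] x
  by (simp add: conjugate_set_eq_image)

lemma ord_conjugate:
  assumes g: "g \<in> carrier G" and x: "x \<in> carrier G"
  shows "ord (g \<otimes> x \<otimes> inv g) = ord x"
proof -
  have "generate G {x} \<subseteq> carrier G" using generate_incl x by simp
  hence "card ((\<lambda>x. g \<otimes> x \<otimes> inv g) ` generate G {x}) = card (generate G {x})"
    by (intro card_image inj_on_subset[OF inj_on_conjugation[OF g]])
  thus ?thesis
    using generate_pow_card[OF x] generate_pow_card[of "g \<otimes> x \<otimes> inv g"] g x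
    by (simp add: generate_conjugate conjugate_set_eq_image)
qed

lemma cyclic_subgroups_eq: "cyclic_subgroups G = (\<lambda>x. generate G {x}) ` carrier G"
proof (intro equalityI subsetI)
  fix C assume "C \<in> cyclic_subgroups G"
  hence C: "subgroup C G" and cyc: "cyclic_group (G\<lparr>carrier := C\<rparr>)" by (auto simp: cyclic_subgroups_def)
  interpret C: group "G\<lparr>carrier := C\<rparr>" using subgroup_imp_group[OF C] .
  obtain x where x: "x \<in> C" "C = range (\<lambda>n::int. x [^]\<^bsub>G\<lparr>carrier := C\<rparr>\<^esub> n)"
    using cyc unfolding C.cyclic_group by auto
  have xc: "x \<in> carrier G" using subgroup.subset[OF C] x by blast
  have "C = generate G {x}" unfolding generate_pow[OF xc]
    by (subst x(2)) (auto simp: int_pow_consistent[OF C x(1)])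
  thus "C \<in> (\<lambda>x. generate G {x}) ` carrier G" using xc by blast
next
  fix C assume "C \<in> (\<lambda>x. generate G {x}) ` carrier G"
  then obtain x where x: "x \<in> carrier G" "C = generate G {x}" by blast
  have "subgroup_generated G {x} = G\<lparr>carrier := C\<rparr>" using x by (simp add: subgroup_generated_def)
  hence "cyclic_group (G\<lparr>carrier := C\<rparr>)" using cyclic_group_generated[of x] by simp
  thus "C \<in> cyclic_subgroups G" using x generate_is_subgroup[of "{x}"] by (simp add: cyclic_subgroups_def)
qed

lemma induced_principal_character_conjugate:
  assumes fin: "finite (carrier G)" and C: "C \<subseteq> carrier G" and g: "g \<in> carrier G"
  defines "D \<equiv> g <# C #> inv g"
  shows "induced G D (principal_character D) = induced G C (principal_character C)"
proof
  fix y
  show "induced G D (principal_character D) y = induced G C (principal_character C) y"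
  proof (cases "y \<in> carrier G")
    case y: True
    have D: "D = (\<lambda>x. g \<otimes> x \<otimes> inv g) ` C" unfolding D_def by (rule conjugate_set_eq_image)
    have cardD: "card D = card C" unfolding D
      by (intro card_image inj_on_subset[OF inj_on_conjugation[OF g] C])
    have mem: "g \<otimes> z \<otimes> inv g \<in> D \<longleftrightarrow> z \<in> C" if "z \<in> carrier G" for z
      unfolding D using inj_on_image_mem_iff[OF inj_on_conjugation[OF g] that C] .
    have "bij_betw (\<lambda>x. g \<otimes> x) {x \<in> carrier G. x \<otimes> y \<otimes> inv x \<in> C} {x \<in> carrier G. x \<otimes> y \<otimes> inv x \<in> D}"
    proof (rule bij_betw_byWitness[where f' = "\<lambda>x. inv g \<otimes> x"])
      have c: "(g \<otimes> x) \<otimes> y \<otimes> inv (g \<otimes> x) = g \<otimes> (x \<otimes> y \<otimes> inv x) \<otimes> inv g" if "x \<in> carrier G" for x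
        using that g y by (simp add: inv_mult_group m_assoc)
      show "(\<lambda>x. g \<otimes> x) ` {x \<in> carrier G. x \<otimes> y \<otimes> inv x \<in> C} \<subseteq> {x \<in> carrier G. x \<otimes> y \<otimes> inv x \<in> D}"
        using g y by (auto simp: c mem)
      show "(\<lambda>x. inv g \<otimes> x) ` {x \<in> carrier G. x \<otimes> y \<otimes> inv x \<in> D} \<subseteq> {x \<in> carrier G. x \<otimes> y \<otimes> inv x \<in> C}"
      proof safe
        fix x assume x: "x \<in> carrier G" "x \<otimes> y \<otimes> inv x \<in> D"
        have "g \<otimes> (inv g \<otimes> x) = x" using g x by (simp flip: m_assoc)
        hence "g \<otimes> ((inv g \<otimes> x) \<otimes> y \<otimes> inv (inv g \<otimes> x)) \<otimes> inv g \<in> D"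
          using c[of "inv g \<otimes> x"] g x by simp
        thus "(inv g \<otimes> x) \<otimes> y \<otimes> inv (inv g \<otimes> x) \<in> C" using mem g x y by simp
      qed (use g in auto)
    qed (use g in \<open>auto simp flip: m_assoc\<close>)
    from bij_betw_same_card[OF this] show ?thesis
      using induced_principal_character[OF fin y] cardD by simp
  qed (simp add: induced_def)
qed

end

section \<open>The span of the rational valued characters\<close>

context group
begin

abbreviation ind1 :: "'a set \<Rightarrow> 'a \<Rightarrow> complex" where
  "ind1 C \<equiv> induced G C (principal_character C)"

lemma cyclic_subgroupD:
  assumes "C \<in> cyclic_subgroups G"
  shows "subgroup C G" "C \<subseteq> carrier G"
  using assms subgroup.subset by (auto simp: cyclic_subgroups_def)

lemma finite_cyclic_subgroups: "finite (carrier G) \<Longrightarrow> finite (cyclic_subgroups G)"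
  by (simp add: cyclic_subgroups_eq)

lemma generate_eq_if_card_eq_ord:
  assumes fin: "finite (carrier G)" and C: "subgroup C G" and y: "y \<in> C" and c: "card C = ord y"
  shows "generate G {y} = C"
proof (rule card_subset_eq)
  have Cc: "C \<subseteq> carrier G" using subgroup.subset[OF C] .
  show "finite C" using Cc fin finite_subset by blast
  show "generate G {y} \<subseteq> C" using generate_subgroup_incl[OF _ C] y by simp
  show "card (generate G {y}) = card C" using generate_pow_card[of y] y Cc c by auto
qed

lemma ord_le_card_subgroup:
  assumes fin: "finite (carrier G)" and C: "subgroup C G" and y: "y \<in> C"
  shows "ord y \<le> card C"
proof -
  have Cc: "C \<subseteq> carrier G" using subgroup.subset[OF C] .
  have "finite C" using Cc fin finite_subset by blast
  moreover have "generate G {y} \<subseteq> C" using generate_subgroup_incl[OF _ C] y by simp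
  ultimately show ?thesis using generate_pow_card[of y] y Cc card_mono[of C "generate G {y}"] by auto
qed

text \<open>
  Induction on a bound \<open>k\<close> for the orders of the elements where \<open>f\<close> does not vanish.  The values on
  elements of order \<open>k + 1\<close> are removed by subtracting a combination of the induced characters from
  all cyclic subgroups \<open>C\<close> of order \<open>k + 1\<close>, with coefficient
  \<open>(k + 1) / card G\<close> times the value of \<open>f\<close> at a generator of \<open>C\<close>.  At \<open>g\<close> of that order the
  combination is the average of \<open>f\<close> over the conjugates of \<open>g\<close>, because a conjugate of \<open>g\<close> lies in
  exactly one such \<open>C\<close>, the one it generates.
\<close>

lemma in_span_if_vanishing_above_order:
  assumes fin: "finite (carrier G)"
  shows "f \<in> rational_class_functions G \<Longrightarrow> (\<And>g. g \<in> carrier G \<Longrightarrow> ord g > k \<Longrightarrow> f g = 0) \<Longrightarrow>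
    f \<in> cfun.span (ind1 ` cyclic_subgroups G)"
proof (induction k arbitrary: f)
  case 0
  have "f = 0"
  proof
    fix g show "f g = 0 g"
    proof (cases "g \<in> carrier G")
      case True
      have "ord g > 0" using ord_ge_1[OF fin True] by simp
      thus ?thesis using "0.prems"(2)[OF True] by simp
    next
      case False
      have "\<forall>x. x \<notin> carrier G \<longrightarrow> f x = 0"
        using "0.prems"(1) unfolding rational_class_functions_def class_functions_def by blast
      thus ?thesis using False by simp
    qed
  qed
  thus ?case by (simp only: cfun.span_zero)
next
  case (Suc k)
  let ?S = "cfun.span (ind1 ` cyclic_subgroups G)"
  have f: "f \<in> class_functions G"
    and fgen: "\<And>x y. x \<in> carrier G \<Longrightarrow> y \<in> carrier G \<Longrightarrow> generate G {x} = generate G {y} \<Longrightarrow> f x = f y"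
    using Suc.prems(1) unfolding rational_class_functions_def by blast+
  define gn where "gn C = (SOME x. x \<in> carrier G \<and> generate G {x} = C)" for C
  have gn: "gn (generate G {x}) \<in> carrier G" "generate G {gn (generate G {x})} = generate G {x}"
    if "x \<in> carrier G" for x
    using someI[of "\<lambda>z. z \<in> carrier G \<and> generate G {z} = generate G {x}" x] that unfolding gn_def by auto
  define T where "T = {C \<in> cyclic_subgroups G. card C = Suc k}"
  have finT: "finite T" using finite_cyclic_subgroups[OF fin] by (simp add: T_def)
  define a where "a C = f (gn C) * of_nat (Suc k) / of_nat (card (carrier G))" for C
  define h where "h = (\<Sum>C\<in>T. (\<lambda>g. a C * ind1 C g))"
  have hS: "h \<in> ?S" unfolding h_def
    by (intro cfun.span_sum cfun.span_scale cfun.span_base) (auto simp: T_def)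
  have h_apply: "h g = (\<Sum>C\<in>T. a C * ind1 C g)" for g
    unfolding h_def using finT by (induction T rule: finite_induct) auto
  have "?S \<subseteq> rational_class_functions G"
  proof (rule cfun.span_minimal[OF _ subspace_rational_class_functions], safe)
    fix C assume "C \<in> cyclic_subgroups G"
    thus "ind1 C \<in> rational_class_functions G"
      using induced_principal_character_in_span[OF fin cyclic_subgroupD(1)] rational_character_span_subset[OF fin] by blast
  qed
  hence "f - h \<in> rational_class_functions G"
    using Suc.prems(1) hS cfun.subspace_diff[OF subspace_rational_class_functions] by blast
  moreover have "(f - h) g = 0" if g: "g \<in> carrier G" and og: "ord g > k" for g
  proof (cases "ord g = Suc k")
    case False
    hence og: "ord g > Suc k" using og by simp
    have "ind1 C g = 0" if "C \<in> T" for C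
    proof -
      have C: "subgroup C G" "card C = Suc k" using that cyclic_subgroupD by (auto simp: T_def)
      have "x \<otimes> g \<otimes> inv x \<notin> C" if x: "x \<in> carrier G" for x
        using ord_le_card_subgroup[OF fin C(1), of "x \<otimes> g \<otimes> inv x"] ord_conjugate[OF x g] C(2) og by auto
      hence "{x \<in> carrier G. x \<otimes> g \<otimes> inv x \<in> C} = {}" by blast
      thus ?thesis by (simp only: induced_principal_character[OF fin g] card.empty of_nat_0 div_0)
    qed
    thus ?thesis using Suc.prems(2)[OF g og] by (simp add: h_apply)
  next
    case True
    have cj: "x \<otimes> g \<otimes> inv x \<in> carrier G" if "x \<in> carrier G" for x using that g by simp
    have "h g = (\<Sum>C\<in>T. \<Sum>x\<in>carrier G. if x \<otimes> g \<otimes> inv x \<in> C then f (gn C) else 0) / of_nat (card (carrier G))"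
    proof -
      have "a C * ind1 C g = (\<Sum>x\<in>carrier G. if x \<otimes> g \<otimes> inv x \<in> C then f (gn C) else 0) / of_nat (card (carrier G))"
        if "C \<in> T" for C
      proof -
        have "a C * ind1 C g = f (gn C) * of_nat (card {x \<in> carrier G. x \<otimes> g \<otimes> inv x \<in> C}) / of_nat (card (carrier G))"
          using that unfolding induced_principal_character[OF fin g] a_def T_def by (simp del: of_nat_Suc)
        thus ?thesis by (simp add: fin mult.commute flip: sum.inter_filter)
      qed
      thus ?thesis by (simp add: h_apply sum_divide_distrib)
    qed
    also have "(\<Sum>C\<in>T. \<Sum>x\<in>carrier G. if x \<otimes> g \<otimes> inv x \<in> C then f (gn C) else 0) =
       (\<Sum>x\<in>carrier G. \<Sum>C\<in>T. if x \<otimes> g \<otimes> inv x \<in> C then f (gn C) else 0)" by (rule sum.swap)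
    also have "\<dots> = (\<Sum>x\<in>carrier G. f g)"
    proof (rule sum.cong)
      fix x assume x: "x \<in> carrier G"
      define y where "y = x \<otimes> g \<otimes> inv x"
      have y: "y \<in> carrier G" "ord y = Suc k" using cj[OF x] ord_conjugate[OF x g] True by (simp_all add: y_def)
      have gy: "generate G {y} \<in> T"
        using y generate_pow_card[OF y(1)] by (auto simp: T_def cyclic_subgroups_eq)
      have "y \<in> C \<longleftrightarrow> C = generate G {y}" if "C \<in> T" for C
        using that generate_eq_if_card_eq_ord[OF fin, of C y] cyclic_subgroupD(1)[of C] y generate.incl[of y "{y}" G]
        by (auto simp: T_def)
      hence "(\<Sum>C\<in>T. if y \<in> C then f (gn C) else 0) = (\<Sum>C\<in>T. if C = generate G {y} then f (gn C) else 0)"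
        by (intro sum.cong) auto
      also have "\<dots> = f (gn (generate G {y}))" using finT gy by simp
      also have "\<dots> = f y" using fgen gn[OF y(1)] y(1) by blast
      also have "\<dots> = f g" using f g x unfolding class_functions_def y_def by blast
      finally show "(\<Sum>C\<in>T. if x \<otimes> g \<otimes> inv x \<in> C then f (gn C) else 0) = f g" by (simp add: y_def)
    qed simp
    also have "\<dots> / of_nat (card (carrier G)) = f g"
      using fin one_closed by (auto simp: card_eq_0_iff)
    finally show ?thesis by simp
  qed
  ultimately have "f - h \<in> ?S" by (rule Suc.IH)
  hence "(f - h) + h \<in> ?S" using hS by (rule cfun.span_add)
  thus ?case by simp
qed

theorem rational_character_span_eq:
  assumes fin: "finite (carrier G)"
  shows "rational_character_span G = rational_class_functions G"
    and "rational_character_span G = cfun.span (ind1 ` cyclic_subgroups G)"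
proof -
  have 1: "rational_character_span G \<subseteq> rational_class_functions G"
    by (rule rational_character_span_subset[OF fin])
  have 2: "rational_class_functions G \<subseteq> cfun.span (ind1 ` cyclic_subgroups G)"
  proof
    fix f assume f: "f \<in> rational_class_functions G"
    show "f \<in> cfun.span (ind1 ` cyclic_subgroups G)"
    proof (rule in_span_if_vanishing_above_order[OF fin f, where k = "Coset.order G"])
      fix g assume "g \<in> carrier G" "Coset.order G < ord g"
      thus "f g = 0" using ord_le_group_order[OF fin, of g] by simp
    qed
  qed
  have 3: "cfun.span (ind1 ` cyclic_subgroups G) \<subseteq> rational_character_span G"
    unfolding rational_character_span_def[of G]
  proof (rule cfun.span_minimal[OF _ cfun.subspace_span], safe)
    fix C assume "C \<in> cyclic_subgroups G"
    thus "ind1 C \<in> cfun.span {\<chi>. is_character G \<chi> \<and> rational_valued G \<chi>}"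
      using induced_principal_character_in_span[OF fin cyclic_subgroupD(1)]
      unfolding rational_character_span_def by blast
  qed
  show "rational_character_span G = rational_class_functions G"
    by (rule subset_antisym[OF 1 subset_trans[OF 2 3]])
  show "rational_character_span G = cfun.span (ind1 ` cyclic_subgroups G)"
    by (rule subset_antisym[OF subset_trans[OF 1 2] 3])
qed

end

section \<open>Counting conjugacy classes of cyclic subgroups\<close>

lemma subspace_vanishing_at: "cfun.subspace {f. f a = 0}"
  by (auto simp: cfun.subspace_def)

lemma independent_if_separated:
  assumes "\<And>v. v \<in> S \<Longrightarrow> \<exists>a. v a \<noteq> 0 \<and> (\<forall>w\<in>S - {v}. w a = 0)"
  shows "cfun.independent S"
  unfolding cfun.dependent_def
proof
  assume "\<exists>v\<in>S. v \<in> cfun.span (S - {v})"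
  then obtain v where v: "v \<in> S" "v \<in> cfun.span (S - {v})" by blast
  obtain a where a: "v a \<noteq> 0" "\<forall>w\<in>S - {v}. w a = 0" using assms[OF v(1)] by blast
  have "S - {v} \<subseteq> {f. f a = 0}" using a(2) by blast
  hence "cfun.span (S - {v}) \<subseteq> {f. f a = 0}" by (rule cfun.span_minimal[OF _ subspace_vanishing_at])
  thus False using v(2) a(1) by blast
qed

context group
begin

text \<open>
  The conjugation action restricts its argument to the set of cyclic subgroups; on that set it is
  ordinary conjugation.
\<close>

lemma cyclic_subgroup_classes_eq:
  "cyclic_subgroup_classes G = (\<lambda>C. (\<lambda>g. g <# C #> inv g) ` carrier G) ` cyclic_subgroups G"
proof -
  have "orbit G (\<lambda>g. \<lambda>H\<in>cyclic_subgroups G. g <# H #> inv g) C = (\<lambda>g. g <# C #> inv g) ` carrier G"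
    if "C \<in> cyclic_subgroups G" for C
    using that by (auto simp: orbit_def)
  thus ?thesis unfolding cyclic_subgroup_classes_def orbits_def by auto
qed

lemma conjugate_conjugate:
  assumes "C \<subseteq> carrier G" "g \<in> carrier G" "h \<in> carrier G"
  shows "g <# (h <# C #> inv h) #> inv g = (g \<otimes> h) <# C #> inv (g \<otimes> h)"
  unfolding conjugate_set_eq_image image_image
  by (rule image_cong) (use assms in \<open>auto simp: inv_mult_group m_assoc\<close>)

lemma conjugacy_class_unique:
  assumes K: "K \<in> cyclic_subgroup_classes G" and C: "C \<in> K"
  shows "K = (\<lambda>g. g <# C #> inv g) ` carrier G"
proof -
  obtain D where D: "D \<in> cyclic_subgroups G" "K = (\<lambda>g. g <# D #> inv g) ` carrier G"
    using K by (auto simp: cyclic_subgroup_classes_eq)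
  have Dc: "D \<subseteq> carrier G" using cyclic_subgroupD[OF D(1)] by simp
  obtain h where h: "h \<in> carrier G" "C = h <# D #> inv h" using C D by blast
  show ?thesis unfolding D(2)
  proof (intro equalityI subsetI)
    fix E assume "E \<in> (\<lambda>g. g <# D #> inv g) ` carrier G"
    then obtain g where g: "g \<in> carrier G" "E = g <# D #> inv g" by blast
    have "E = (g \<otimes> inv h) <# C #> inv (g \<otimes> inv h)"
      using conjugate_conjugate[OF Dc, of "g \<otimes> inv h" h] g h by (simp add: m_assoc)
    thus "E \<in> (\<lambda>g. g <# C #> inv g) ` carrier G" using g h by blast
  next
    fix E assume "E \<in> (\<lambda>g. g <# C #> inv g) ` carrier G"
    then obtain g where g: "g \<in> carrier G" "E = g <# C #> inv g" by blast
    have "E = (g \<otimes> h) <# D #> inv (g \<otimes> h)"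
      using conjugate_conjugate[OF Dc g(1) h(1)] g h by simp
    thus "E \<in> (\<lambda>g. g <# D #> inv g) ` carrier G" using g h by blast
  qed
qed

lemma conjugate_cyclic_subgroup:
  assumes "C \<in> cyclic_subgroups G" "g \<in> carrier G"
  shows "g <# C #> inv g \<in> cyclic_subgroups G"
proof -
  obtain x where "x \<in> carrier G" "C = generate G {x}" using assms(1) by (auto simp: cyclic_subgroups_eq)
  thus ?thesis using generate_conjugate[OF assms(2), of x] assms(2) by (auto simp: cyclic_subgroups_eq)
qed

lemma in_conjugacy_class:
  assumes "C \<in> cyclic_subgroups G"
  shows "C \<in> (\<lambda>g. g <# C #> inv g) ` carrier G"
proof -
  have "C = \<one> <# C #> inv \<one>"
    using cyclic_subgroupD(2)[OF assms] unfolding conjugate_set_eq_image by force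
  thus ?thesis by blast
qed

definition class_indicator :: "'a set set \<Rightarrow> 'a \<Rightarrow> complex" where
  "class_indicator K g = (if g \<in> carrier G \<and> generate G {g} \<in> K then 1 else 0)"

lemma class_indicator_rational_class_function:
  assumes K: "K \<in> cyclic_subgroup_classes G"
  shows "class_indicator K \<in> rational_class_functions G"
proof -
  have "generate G {g \<otimes> x \<otimes> inv g} \<in> K \<longleftrightarrow> generate G {x} \<in> K"
    if x: "x \<in> carrier G" and g: "g \<in> carrier G" for x g
  proof
    assume "generate G {x} \<in> K"
    thus "generate G {g \<otimes> x \<otimes> inv g} \<in> K"
      using conjugacy_class_unique[OF K] generate_conjugate[OF g x] g by blast
  next
    assume "generate G {g \<otimes> x \<otimes> inv g} \<in> K"
    hence "inv g <# generate G {g \<otimes> x \<otimes> inv g} #> inv (inv g) \<in> K"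
      using conjugacy_class_unique[OF K, of "generate G {g \<otimes> x \<otimes> inv g}"] g by blast
    also have "inv g <# generate G {g \<otimes> x \<otimes> inv g} #> inv (inv g) = generate G {x}"
      using generate_conjugate[of "inv g" "g \<otimes> x \<otimes> inv g"] conjugation_cancel(1)[OF g x] g x by simp
    finally show "generate G {x} \<in> K" .
  qed
  thus ?thesis
    unfolding rational_class_functions_def class_functions_def class_indicator_def by auto
qed

lemma class_indicator_separates:
  assumes K: "K \<in> cyclic_subgroup_classes G"
  shows "\<exists>g. \<forall>L\<in>cyclic_subgroup_classes G. class_indicator L g = (if L = K then 1 else 0)"
proof -
  obtain C where C: "C \<in> cyclic_subgroups G" "K = (\<lambda>g. g <# C #> inv g) ` carrier G"
    using K by (auto simp: cyclic_subgroup_classes_eq)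
  obtain g where g: "g \<in> carrier G" "C = generate G {g}" using C(1) by (auto simp: cyclic_subgroups_eq)
  have CK: "C \<in> K" using C in_conjugacy_class by blast
  have "C \<in> L \<longleftrightarrow> L = K" if "L \<in> cyclic_subgroup_classes G" for L
    using conjugacy_class_unique[OF that, of C] C(2) CK by blast
  thus ?thesis using g by (intro exI[of _ g]) (simp add: class_indicator_def)
qed

text \<open>
  The indicator functions of the classes are independent in the spanned space, since a generator of
  a member of a class separates its indicator from all others.
\<close>

lemma card_spanning_ge_card_classes:
  assumes fin: "finite (carrier G)" and B: "finite B" "cfun.span B = rational_character_span G"
  shows "card (cyclic_subgroup_classes G) \<le> card B"
proof -
  let ?I = "class_indicator ` cyclic_subgroup_classes G"
  have inj: "inj_on class_indicator (cyclic_subgroup_classes G)"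
  proof (rule inj_onI)
    fix K L assume K: "K \<in> cyclic_subgroup_classes G" and L: "L \<in> cyclic_subgroup_classes G"
      and eq: "class_indicator K = class_indicator L"
    obtain g where "\<forall>M\<in>cyclic_subgroup_classes G. class_indicator M g = (if M = K then 1 else 0)"
      using class_indicator_separates[OF K] by blast
    thus "K = L" using K L eq by (metis zero_neq_one)
  qed
  have "cfun.independent ?I"
  proof (rule independent_if_separated)
    fix v assume "v \<in> ?I"
    then obtain K where K: "K \<in> cyclic_subgroup_classes G" "v = class_indicator K" by blast
    obtain g where "\<forall>M\<in>cyclic_subgroup_classes G. class_indicator M g = (if M = K then 1 else 0)"
      using class_indicator_separates[OF K(1)] by blast
    thus "\<exists>a. v a \<noteq> 0 \<and> (\<forall>w\<in>?I - {v}. w a = 0)" using K by (intro exI[of _ g]) (auto split: if_splits)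
  qed
  moreover have "?I \<subseteq> cfun.span B"
    unfolding B(2) rational_character_span_eq(1)[OF fin]
    using class_indicator_rational_class_function by blast
  ultimately have "card ?I \<le> card B" using cfun.independent_span_bound[OF B(1)] by blast
  thus ?thesis using card_image[OF inj] by simp
qed

lemma ind1_class_cong:
  assumes fin: "finite (carrier G)" and K: "K \<in> cyclic_subgroup_classes G" and CD: "C \<in> K" "D \<in> K"
  shows "ind1 C = ind1 D"
proof -
  obtain E where "E \<in> cyclic_subgroups G" "K = (\<lambda>g. g <# E #> inv g) ` carrier G"
    using K by (auto simp: cyclic_subgroup_classes_eq)
  hence "C \<in> cyclic_subgroups G" using CD(1) conjugate_cyclic_subgroup by blast
  hence Cc: "C \<subseteq> carrier G" by (rule cyclic_subgroupD)
  obtain g where "g \<in> carrier G" "D = g <# C #> inv g"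
    using conjugacy_class_unique[OF K CD(1)] CD(2) by blast
  thus ?thesis using induced_principal_character_conjugate[OF fin Cc] by simp
qed

lemma ex_class:
  assumes "C \<in> cyclic_subgroups G"
  shows "\<exists>K\<in>cyclic_subgroup_classes G. C \<in> K"
  using in_conjugacy_class[OF assms] assms unfolding cyclic_subgroup_classes_eq by blast

lemma finite_cyclic_subgroup_classes: "finite (carrier G) \<Longrightarrow> finite (cyclic_subgroup_classes G)"
  by (simp add: cyclic_subgroup_classes_eq finite_cyclic_subgroups)

text \<open>
  The induced character of \<open>C\<close> is a function of the class of \<open>C\<close>, so a family that meets only
  \<open>r\<close> classes has at most \<open>r\<close> distinct members, and \<open>r\<close> must be the number of all classes if it
  spans.
\<close>

lemma spanning_iff_all_classes_represented:
  assumes fin: "finite (carrier G)" and I: "finite I" and C: "\<And>i. i \<in> I \<Longrightarrow> C i \<in> cyclic_subgroups G"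
  shows "cfun.span ((\<lambda>i. ind1 (C i)) ` I) = rational_character_span G \<longleftrightarrow>
    (\<forall>K\<in>cyclic_subgroup_classes G. \<exists>i\<in>I. C i \<in> K)"
proof
  assume sp: "cfun.span ((\<lambda>i. ind1 (C i)) ` I) = rational_character_span G"
  define R where "R = {K \<in> cyclic_subgroup_classes G. \<exists>i\<in>I. C i \<in> K}"
  have finR: "finite R" using finite_cyclic_subgroup_classes[OF fin] by (simp add: R_def)
  have "(\<lambda>i. ind1 (C i)) ` I \<subseteq> (\<lambda>K. ind1 (SOME D. D \<in> K)) ` R"
  proof safe
    fix i assume i: "i \<in> I"
    obtain K where K: "K \<in> cyclic_subgroup_classes G" "C i \<in> K" using ex_class[OF C[OF i]] by blast
    have "(SOME D. D \<in> K) \<in> K" using K(2) by (rule someI)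
    hence "ind1 (C i) = ind1 (SOME D. D \<in> K)" using ind1_class_cong[OF fin K] by blast
    thus "ind1 (C i) \<in> (\<lambda>K. ind1 (SOME D. D \<in> K)) ` R" using K i unfolding R_def by blast
  qed
  hence "card ((\<lambda>i. ind1 (C i)) ` I) \<le> card R" using finR by (rule surj_card_le[rotated])
  hence "card (cyclic_subgroup_classes G) \<le> card R"
    using card_spanning_ge_card_classes[OF fin _ sp] I by simp
  hence "R = cyclic_subgroup_classes G"
    using finite_cyclic_subgroup_classes[OF fin] by (intro card_seteq) (auto simp: R_def)
  thus "\<forall>K\<in>cyclic_subgroup_classes G. \<exists>i\<in>I. C i \<in> K" unfolding R_def by blast
next
  assume all: "\<forall>K\<in>cyclic_subgroup_classes G. \<exists>i\<in>I. C i \<in> K"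
  have "ind1 ` cyclic_subgroups G \<subseteq> (\<lambda>i. ind1 (C i)) ` I"
  proof safe
    fix D assume "D \<in> cyclic_subgroups G"
    then obtain K where K: "K \<in> cyclic_subgroup_classes G" "D \<in> K" using ex_class by blast
    then obtain i where i: "i \<in> I" "C i \<in> K" using all by blast
    have "ind1 D = ind1 (C i)" using ind1_class_cong[OF fin K i(2)] .
    thus "ind1 D \<in> (\<lambda>i. ind1 (C i)) ` I" using i by blast
  qed
  moreover have "(\<lambda>i. ind1 (C i)) ` I \<subseteq> ind1 ` cyclic_subgroups G" using C by blast
  ultimately show "cfun.span ((\<lambda>i. ind1 (C i)) ` I) = rational_character_span G"
    using rational_character_span_eq(2)[OF fin] by (simp add: subset_antisym)
qed

text \<open>
  Two members in the same class would coincide.  Conversely, a family with one member per class has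
  no more members than any spanning set must have, so none of its members can be repeated or lie in
  the span of the others.
\<close>

lemma basis_iff_class_representatives:
  assumes fin: "finite (carrier G)" and I: "finite I" and C: "\<And>i. i \<in> I \<Longrightarrow> C i \<in> cyclic_subgroups G"
  shows "basis_family I (\<lambda>i. ind1 (C i)) (rational_character_span G) \<longleftrightarrow>
    (\<forall>K\<in>cyclic_subgroup_classes G. \<exists>!i. i \<in> I \<and> C i \<in> K)"
proof
  assume bas: "basis_family I (\<lambda>i. ind1 (C i)) (rational_character_span G)"
  hence inj: "inj_on (\<lambda>i. ind1 (C i)) I"
    and sp: "cfun.span ((\<lambda>i. ind1 (C i)) ` I) = rational_character_span G"
    by (simp_all add: basis_family_def)
  show "\<forall>K\<in>cyclic_subgroup_classes G. \<exists>!i. i \<in> I \<and> C i \<in> K"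
  proof
    fix K assume K: "K \<in> cyclic_subgroup_classes G"
    obtain i where i: "i \<in> I" "C i \<in> K"
      using sp spanning_iff_all_classes_represented[of I C, OF fin I C] K by blast
    show "\<exists>!i. i \<in> I \<and> C i \<in> K"
    proof (rule ex1I[of _ i])
      fix j assume "j \<in> I \<and> C j \<in> K"
      thus "j = i" using ind1_class_cong[OF fin K, of "C j" "C i"] i inj_onD[OF inj, of j i] by blast
    qed (use i in blast)
  qed
next
  assume ex1: "\<forall>K\<in>cyclic_subgroup_classes G. \<exists>!i. i \<in> I \<and> C i \<in> K"
  define B where "B = (\<lambda>i. ind1 (C i)) ` I"
  have sp: "cfun.span B = rational_character_span G"
    unfolding B_def using spanning_iff_all_classes_represented[of I C, OF fin I C] ex1 by blast
  have finB: "finite B" using I by (simp add: B_def)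
  have "I \<subseteq> (\<lambda>K. THE i. i \<in> I \<and> C i \<in> K) ` cyclic_subgroup_classes G"
  proof
    fix i assume i: "i \<in> I"
    obtain K where K: "K \<in> cyclic_subgroup_classes G" "C i \<in> K" using ex_class[OF C[OF i]] by blast
    have "(THE i. i \<in> I \<and> C i \<in> K) = i" using ex1 K i by (intro the1_equality) auto
    thus "i \<in> (\<lambda>K. THE i. i \<in> I \<and> C i \<in> K) ` cyclic_subgroup_classes G" using K by blast
  qed
  hence cI: "card I \<le> card (cyclic_subgroup_classes G)"
    by (rule surj_card_le[OF finite_cyclic_subgroup_classes[OF fin]])
  have cB: "card (cyclic_subgroup_classes G) \<le> card B" by (rule card_spanning_ge_card_classes[OF fin finB sp])
  have "card B \<le> card I" unfolding B_def using I by (rule card_image_le)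
  hence "card B = card I" using cI cB by simp
  hence "inj_on (\<lambda>i. ind1 (C i)) I" unfolding B_def using I by (intro eq_card_imp_inj_on)
  moreover have "cfun.independent B"
  proof (unfold cfun.dependent_def, rule notI)
    assume "\<exists>a\<in>B. a \<in> cfun.span (B - {a})"
    then obtain a where a: "a \<in> B" "a \<in> cfun.span (B - {a})" by blast
    have "cfun.span (B - {a}) = cfun.span B"
      using cfun.span_redundant[OF a(2)] a(1) by (simp add: insert_absorb)
    hence "card (cyclic_subgroup_classes G) \<le> card (B - {a})"
      using card_spanning_ge_card_classes[OF fin, of "B - {a}"] finB sp by simp
    also have "\<dots> < card B" using finB a(1) by (rule card_Diff1_less)
    finally show False using cI \<open>card B \<le> card I\<close> by simp
  qed
  ultimately show "basis_family I (\<lambda>i. ind1 (C i)) (rational_character_span G)"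
    using sp by (simp add: basis_family_def B_def)
qed

end

theorem theorem3:
  fixes G :: "('a, 'b) monoid_scheme" and C :: "nat \<Rightarrow> 'a set" and n :: nat
  assumes "group G" and "finite (carrier G)"
    and "\<And>i. i \<in> {1..n} \<Longrightarrow> C i \<in> cyclic_subgroups G"
  shows "(cfun.span ((\<lambda>i. induced G (C i) (principal_character (C i))) ` {1..n})
            = rational_character_span G
          \<longleftrightarrow> (\<forall>K\<in>cyclic_subgroup_classes G. \<exists>i\<in>{1..n}. C i \<in> K))
       \<and> (basis_family {1..n} (\<lambda>i. induced G (C i) (principal_character (C i)))
            (rational_character_span G)
          \<longleftrightarrow> (\<forall>K\<in>cyclic_subgroup_classes G. \<exists>!i. i \<in> {1..n} \<and> C i \<in> K))"
  using group.spanning_iff_all_classes_represented[of G "{1..n}" C, OF assms(1,2) _ assms(3)]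
    group.basis_iff_class_representatives[of G "{1..n}" C, OF assms(1,2) _ assms(3)]
  by blast

end
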